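(* Let $(\mathbf d_n)_{n\ge1}$ be a family of degree sequences and $v_n\in[n]$. Assume, as $n\to\infty$, \[\sigma^2(\mathbf d_n)=o\Big(\frac{n}{(\log n)^3}\Big),\qquad \sigma^2(\mathbf d_n)=\omega(n^{-1}),\qquad \Delta(\mathbf d_n)=o\Big(\sqrt{\frac{n\sigma^2(\mathbf d_n)}{(\log n)^3}}\Big).\] Let $X$ and $U$ be independent, $U$ uniform on $[0,1]$ and $X$ standard Rayleigh distributed ($\mathbb P(X>x)=e^{-x^2/2}$, $x>0$). Then \[\Big(\frac{\mathfrak s_n(v_n)}{\sqrt{n/\sigma^2(\mathbf d_n)}},\ \frac{\mathfrak t_n(v_n)}{\sqrt{n/\sigma^2(\mathbf d_n)}}\Big)\xrightarrow{d}(X,UX).\]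
   Context: A degree sequence is $\mathbf d_n=(d_{n,1},\ldots,d_{n,n})\in\mathbb N_0^n$ with $\sum_j d_{n,j}=n$. For such a sequence let $\mathfrak F(\mathbf d_n)=\{f:[n]\to[n]: |f^{-1}(\{i\})|=d_{n,i}\ \forall i\in[n]\}$; $F$ denotes a uniform element of $\mathfrak F(\mathbf d_n)$. For $f:V\to V$ and $v\in V$, the six-length is $\mathfrak s_f(v)=\min\{k\in\mathbb N: f^{(k)}(v)\in\{f^{(j)}(v):0\le j\le k-1\}\}$ ($f^{(k)}$ the $k$-fold composition, $f^{(0)}=\mathrm{id}$), and the tail-length $\mathfrak t_f(v)$ is the unique integer with $0\le\mathfrak t_f(v)<\mathfrak s_f(v)$ and $f^{(\mathfrak s_f(v))}(v)=f^{(\mathfrak t_f(v))}(v)$. Write $\mathfrak s_n(v)=\mathfrak s_F(v)$, $\mathfrak t_n(v)=\mathfrak t_F(v)$. Notation: $\Delta(\mathbf d_n)=\max_j d_{n,j}$, $m_k(\mathbf d_n)=\sum_j d_{n,j}^k$, $\sigma^2(\mathbf d_n)=m_2(\mathbf d_n)/n-1$. $a_n=\omega(b_n)$ means $b_n=o(a_n)$. *)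

theory Defs
  imports "HOL-Probability.Probability" "HOL-Library.Landau_Symbols"
begin

definition degree_seq :: "nat \<Rightarrow> (nat \<Rightarrow> nat) \<Rightarrow> bool" where
  "degree_seq n d \<longleftrightarrow> (\<Sum>j=1..n. d j) = n"

definition funs_deg :: "nat \<Rightarrow> (nat \<Rightarrow> nat) \<Rightarrow> (nat \<Rightarrow> nat) set" where
  "funs_deg n d = {f \<in> {1..n} \<rightarrow>\<^sub>E {1..n}. \<forall>i\<in>{1..n}. card {j\<in>{1..n}. f j = i} = d i}"

definition max_deg :: "nat \<Rightarrow> (nat \<Rightarrow> nat) \<Rightarrow> nat" where
  "max_deg n d = Max (d ` {1..n})"

definition moment :: "nat \<Rightarrow> nat \<Rightarrow> (nat \<Rightarrow> nat) \<Rightarrow> nat" where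
  "moment k n d = (\<Sum>j=1..n. d j ^ k)"

definition sigma2 :: "nat \<Rightarrow> (nat \<Rightarrow> nat) \<Rightarrow> real" where
  "sigma2 n d = real (moment 2 n d) / real n - 1"

definition rho_len :: "('a \<Rightarrow> 'a) \<Rightarrow> 'a \<Rightarrow> nat" where
  "rho_len f v = (LEAST k. k \<ge> 1 \<and> (f ^^ k) v \<in> {(f ^^ j) v | j. j \<le> k - 1})"

definition tail_len :: "('a \<Rightarrow> 'a) \<Rightarrow> 'a \<Rightarrow> nat" where
  "tail_len f v = (THE t. t < rho_len f v \<and> (f ^^ rho_len f v) v = (f ^^ t) v)"

definition conv_distr2 :: "(nat \<Rightarrow> (real \<times> real) measure) \<Rightarrow> (real \<times> real) measure \<Rightarrow> bool" where
  "conv_distr2 M L \<longleftrightarrow>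
     (\<forall>g :: real \<times> real \<Rightarrow> real. continuous_on UNIV g \<longrightarrow> bounded (range g) \<longrightarrow>
        (\<lambda>n. integral\<^sup>L (M n) g) \<longlonglongrightarrow> integral\<^sup>L L g)"

definition rayleigh :: "real measure" where
  "rayleigh = density lborel (\<lambda>x. ennreal (indicator {0<..} x * x * exp (- x\<^sup>2 / 2)))"

definition unif01 :: "real measure" where
  "unif01 = uniform_measure lborel {0..1}"

definition limit_law :: "(real \<times> real) measure" where
  "limit_law = distr (rayleigh \<Otimes>\<^sub>M unif01) borel (\<lambda>(x, u). (x, u * x))"

definition scaled_law :: "nat \<Rightarrow> (nat \<Rightarrow> nat) \<Rightarrow> nat \<Rightarrow> (real \<times> real) measure" where
  "scaled_law n d v = distr (measure_pmf (pmf_of_set (funs_deg n d))) borel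
     (\<lambda>f. (real (rho_len f v) / sqrt (real n / sigma2 n d),
           real (tail_len f v) / sqrt (real n / sigma2 n d)))"

end

theory Submission
  imports Defs
begin

text \<open>
  Follow the orbit of \<open>v\<close> until it first repeats. The probability of seeing a given sequence of \<open>k\<close>
  distinct new vertices is the product of their degrees divided by the falling factorial \<open>(n)\<^sub>k\<close>, and
  given that the first repetition occurs at time \<open>k + 1\<close> and does not hit \<open>v\<close>, the tail-length is
  uniform on \<open>{1..k}\<close> by symmetry. Hence everything reduces to weighted elementary symmetric sums
  \<open>Q\<^sub>k(S)\<close> of the degrees. The deletion identity \<open>Q\<^sub>k(S) = Q\<^sub>k(S - i) + k d\<^sub>i Q\<^bsub>k-1\<^esub>(S - i)\<close> shows that, as
  long as \<open>k \<Delta> = o(n)\<close>, conditioning on no repetition up to time \<open>k\<close> does not change the mean excess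
  degree of a visited vertex, so the hazard rate at time \<open>k\<close> is \<open>k \<sigma>\<^sup>2 / n\<close> up to a factor \<open>1 + o(1)\<close>.
  This gives a local limit theorem for the six-length with the Rayleigh density as limit. Since that
  density has mass 1, Scheffe's argument upgrades it to weak convergence of the pair and shows that
  tail-length 0 has vanishing probability.
\<close>

subsection \<open>Weighted sums over injective lists\<close>

definition inj_lists :: "nat \<Rightarrow> 'a set \<Rightarrow> 'a list set" where
  "inj_lists k S = {xs. length xs = k \<and> distinct xs \<and> set xs \<subseteq> S}"

text \<open>This is \<open>k!\<close> times the \<open>k\<close>-th elementary symmetric polynomial
  of the weights on \<open>S\<close>, written \<open>Q\<close> in the overview. Ordered lists are
  summed because an orbit is an ordered list of distinct vertices.\<close>

definition wsum :: "('a \<Rightarrow> real) \<Rightarrow> nat \<Rightarrow> 'a set \<Rightarrow> real" where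
  "wsum w k S = (\<Sum>xs\<in>inj_lists k S. prod_list (map w xs))"

lemma finite_inj_lists: "finite S \<Longrightarrow> finite (inj_lists k S)"
  unfolding inj_lists_def
  by (rule finite_subset[OF _ finite_lists_length_eq[of S k]]) auto

lemma inj_lists_0: "inj_lists 0 S = {[]}"
  by (auto simp: inj_lists_def)

lemma inj_lists_Suc: "inj_lists (Suc k) S = (\<Union>i\<in>S. (#) i ` inj_lists k (S - {i}))"
proof (intro set_eqI iffI)
  fix xs assume "xs \<in> inj_lists (Suc k) S"
  then show "xs \<in> (\<Union>i\<in>S. (#) i ` inj_lists k (S - {i}))"
    by (cases xs) (auto simp: inj_lists_def)
qed (auto simp: inj_lists_def)

lemma sum_inj_lists_Suc:
  assumes "finite S"
  shows "(\<Sum>xs\<in>inj_lists (Suc k) S. h xs) = (\<Sum>i\<in>S. \<Sum>xs\<in>inj_lists k (S - {i}). h (i # xs))"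
  unfolding inj_lists_Suc using assms
  by (subst sum.UNION_disjoint) (auto simp: finite_inj_lists sum.reindex)

lemma wsum_0: "wsum w 0 S = 1"
  by (simp add: wsum_def inj_lists_0)

lemma wsum_Suc:
  "finite S \<Longrightarrow> wsum w (Suc k) S = (\<Sum>i\<in>S. w i * wsum w k (S - {i}))"
  by (simp add: wsum_def sum_inj_lists_Suc sum_distrib_left)

lemma wsum_nonneg:
  assumes "\<And>i. w i \<ge> 0"
  shows "wsum w k S \<ge> 0"
  unfolding wsum_def by (intro sum_nonneg prod_list_nonneg) (auto simp: assms)

lemma wsum_mono:
  assumes "\<And>i. w i \<ge> 0" "finite S" "T \<subseteq> S"
  shows "wsum w k T \<le> wsum w k S"
  unfolding wsum_def using assms
  by (intro sum_mono2 finite_inj_lists prod_list_nonneg) (auto simp: inj_lists_def)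

text \<open>A list either avoids \<open>i\<close> or contains it at exactly one of its
  \<open>Suc k\<close> positions, and removing it there leaves a list over \<open>S - {i}\<close>.
  The induction formalises this by peeling off the head: it is \<open>i\<close> itself, or some
  other \<open>j\<close>, and then the hypothesis applies to \<open>S - {j}\<close>.\<close>

lemma wsum_remove:
  assumes "finite S" "i \<in> S"
  shows "wsum w (Suc k) S = wsum w (Suc k) (S - {i}) + real (Suc k) * w i * wsum w k (S - {i})"
  using assms
proof (induction k arbitrary: S)
  case 0
  then show ?case by (simp add: wsum_Suc wsum_0 sum.remove)
next
  case (Suc k)
  have fin: "finite (S - {i})" using Suc.prems by simp
  have "wsum w (Suc (Suc k)) S
      = w i * wsum w (Suc k) (S - {i}) + (\<Sum>j\<in>S - {i}. w j * wsum w (Suc k) (S - {j}))"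
    using Suc.prems by (simp add: wsum_Suc[of S w "Suc k"] sum.remove)
  also have "(\<Sum>j\<in>S - {i}. w j * wsum w (Suc k) (S - {j}))
      = (\<Sum>j\<in>S - {i}. w j * wsum w (Suc k) (S - {i} - {j}))
        + real (Suc k) * w i * (\<Sum>j\<in>S - {i}. w j * wsum w k (S - {i} - {j}))"
    unfolding sum_distrib_left sum.distrib[symmetric]
  proof (intro sum.cong refl)
    fix j assume j: "j \<in> S - {i}"
    have eq: "S - {j} - {i} = S - {i} - {j}" by auto
    show "w j * wsum w (Suc k) (S - {j}) = w j * wsum w (Suc k) (S - {i} - {j})
        + real (Suc k) * w i * (w j * wsum w k (S - {i} - {j}))"
      by (subst Suc.IH[of "S - {j}"]) (use Suc.prems j in \<open>auto simp: eq algebra_simps\<close>)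
  qed
  also have "(\<Sum>j\<in>S - {i}. w j * wsum w (Suc k) (S - {i} - {j})) = wsum w (Suc (Suc k)) (S - {i})"
    by (rule wsum_Suc[OF fin, symmetric])
  also have "(\<Sum>j\<in>S - {i}. w j * wsum w k (S - {i} - {j})) = wsum w (Suc k) (S - {i})"
    by (rule wsum_Suc[OF fin, symmetric])
  finally show ?case by (simp add: algebra_simps)
qed

text \<open>The weight of a list is symmetric in its entries, so the right-hand side is free of
  \<open>j\<close>. This is the source of the uniform tail-length.\<close>

lemma sum_inj_lists_marked:
  assumes "finite S" "j \<le> k"
  shows "(\<Sum>xs\<in>inj_lists (Suc k) S. u (xs ! j) * prod_list (map w xs))
       = (\<Sum>i\<in>S. u i * w i * wsum w k (S - {i}))"
  using assms
proof (induction j arbitrary: k S)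
  case 0
  then show ?case
    by (simp add: sum_inj_lists_Suc wsum_def sum_distrib_left mult.assoc)
next
  case (Suc j)
  then obtain m where k: "k = Suc m" by (cases k) auto
  have "(\<Sum>xs\<in>inj_lists (Suc k) S. u (xs ! Suc j) * prod_list (map w xs))
      = (\<Sum>i\<in>S. w i * (\<Sum>xs\<in>inj_lists (Suc m) (S - {i}). u (xs ! j) * prod_list (map w xs)))"
    using Suc.prems by (simp add: sum_inj_lists_Suc[where k = "Suc m"] k sum_distrib_left mult_ac)
  also have "\<dots> = (\<Sum>i\<in>S. \<Sum>l\<in>S - {i}. u l * w l * (w i * wsum w m (S - {i} - {l})))"
    using Suc.prems k by (simp add: Suc.IH[where k = m]) (simp add: sum_distrib_left mult_ac)
  \<comment> \<open>The head \<open>i\<close> and the marked entry \<open>l\<close> range over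
    ordered pairs of distinct elements of \<open>S\<close>, so the two sums may be
    exchanged.\<close>
  also have "\<dots> = (\<Sum>l\<in>S. \<Sum>i\<in>S - {l}. u l * w l * (w i * wsum w m (S - {l} - {i})))"
  proof -
    have 1: "S - {i} = {l\<in>S. i \<noteq> l}" "S - {l} = {i\<in>S. i \<noteq> l}" for i l by auto
    have 2: "S - {i} - {l} = S - {l} - {i}" for i l by auto
    have "(\<Sum>i\<in>S. \<Sum>l\<in>{l\<in>S. i \<noteq> l}. g i l) = (\<Sum>l\<in>S. \<Sum>i\<in>{i\<in>S. i \<noteq> l}. g i l)"
      for g :: "'a \<Rightarrow> 'a \<Rightarrow> real"
      by (rule sum.swap_restrict) (use Suc.prems(1) in auto)
    from this[of "\<lambda>i l. u l * w l * (w i * wsum w m (S - {i} - {l}))"] show ?thesis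
      unfolding 1[symmetric] by (subst (asm) (2) 2)
  qed
  also have "\<dots> = (\<Sum>l\<in>S. u l * w l * wsum w k (S - {l}))"
    using Suc.prems by (simp add: k wsum_Suc sum_distrib_left)
  finally show ?case .
qed

text \<open>Letting the later entries repeat the head only adds nonnegative terms.\<close>

lemma wsum_Suc_le:
  assumes "\<And>i. w i \<ge> 0" "finite S"
  shows "wsum w (Suc k) S \<le> sum w S * wsum w k S"
  unfolding wsum_Suc[OF assms(2)] sum_distrib_right
  using assms by (intro sum_mono mult_left_mono wsum_mono) auto

text \<open>Substitutes the deletion identity into the head recursion, so that the leading term
  refers to the full set \<open>S\<close>. The subtracted sum accounts for a new entry that repeats
  one of \<open>Suc k\<close> old ones.\<close>

lemma wsum_Suc_Suc:
  assumes "finite S"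
  shows "wsum w (Suc (Suc k)) S
       = sum w S * wsum w (Suc k) S - real (Suc k) * (\<Sum>i\<in>S. w i * w i * wsum w k (S - {i}))"
proof -
  have "wsum w (Suc (Suc k)) S = (\<Sum>i\<in>S. w i * (wsum w (Suc k) S - real (Suc k) * w i * wsum w k (S - {i})))"
    using assms by (subst wsum_Suc) (auto intro!: sum.cong simp: wsum_remove[of S _ w k])
  then show ?thesis
    by (simp add: algebra_simps sum_subtractf sum_distrib_left sum_distrib_right)
qed

text \<open>The \<open>k\<close> entries already present block at most \<open>k * M\<close> of the
  total weight: one factor in \<open>w i * w i\<close> is bounded by \<open>M\<close>.\<close>

lemma wsum_Suc_ge:
  assumes w: "\<And>i. w i \<ge> 0" "\<And>i. i \<in> S \<Longrightarrow> w i \<le> M" and S: "finite S"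
  shows "(sum w S - real k * M) * wsum w k S \<le> wsum w (Suc k) S"
proof (cases k)
  case 0
  then show ?thesis using S by (simp add: wsum_Suc wsum_0)
next
  case (Suc m)
  have "(\<Sum>i\<in>S. w i * w i * wsum w m (S - {i})) \<le> (\<Sum>i\<in>S. M * (w i * wsum w m (S - {i})))"
    unfolding mult.assoc using w by (intro sum_mono mult_right_mono mult_nonneg_nonneg wsum_nonneg) auto
  also have "\<dots> = M * wsum w k S"
    by (simp add: Suc wsum_Suc[OF S] sum_distrib_left)
  finally have "real k * (\<Sum>i\<in>S. w i * w i * wsum w m (S - {i})) \<le> real k * (M * wsum w k S)"
    by (intro mult_left_mono) auto
  then show ?thesis
    unfolding Suc wsum_Suc_Suc[OF S] by (simp add: algebra_simps)
qed

subsection \<open>Exchangeability and orbits\<close>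

lemma sum_card_swap:
  assumes "finite A" "finite B"
  shows "(\<Sum>a\<in>A. card {b\<in>B. R a b}) = (\<Sum>b\<in>B. card {a\<in>A. R a b})"
  using sum.swap_restrict[OF assms, of "\<lambda>_ _. 1::nat" R] by simp

lemma finite_funs_deg: "finite (funs_deg n d)"
  unfolding funs_deg_def by (rule finite_subset[OF _ finite_PiE[of "{1..n}" "\<lambda>_. {1..n}"]]) auto

lemma funs_deg_image: "f \<in> funs_deg n d \<Longrightarrow> f ` {1..n} \<subseteq> {1..n}"
  unfolding funs_deg_def by auto

lemma funs_deg_fibre:
  "f \<in> funs_deg n d \<Longrightarrow> i \<in> {1..n} \<Longrightarrow> card {j\<in>{1..n}. f j = i} = d i"
  unfolding funs_deg_def by auto

text \<open>Needed for \<open>pmf_of_set\<close> to be the uniform law. Give each vertex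
  \<open>i\<close> exactly \<open>d i\<close> slots; there are \<open>n\<close> slots in all, and
  any bijection \<open>h\<close> from the vertices to the slots followed by \<open>fst\<close> has
  the required fibres.\<close>

lemma funs_deg_nonempty:
  assumes "degree_seq n d"
  shows "funs_deg n d \<noteq> {}"
proof -
  let ?A = "Sigma {1..n} (\<lambda>i. {..<d i})"
  have "card ?A = card {1..n}"
    using assms by (simp add: degree_seq_def)
  then obtain h where h: "bij_betw h {1..n} ?A"
    by (metis finite_atLeastAtMost finite_SigmaI finite_lessThan finite_same_card_bij)
  let ?f = "restrict (fst \<circ> h) {1..n}"
  have "?f \<in> {1..n} \<rightarrow>\<^sub>E {1..n}"
    using bij_betw_apply[OF h] by (fastforce simp: mem_Times_iff)
  moreover have "card {j\<in>{1..n}. ?f j = i} = d i" if i: "i \<in> {1..n}" for i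
  proof -
    have "h ` {j\<in>{1..n}. ?f j = i} = {i} \<times> {..<d i}"
    proof
      show "h ` {j\<in>{1..n}. ?f j = i} \<subseteq> {i} \<times> {..<d i}"
        using bij_betw_apply[OF h] by fastforce
      show "{i} \<times> {..<d i} \<subseteq> h ` {j\<in>{1..n}. ?f j = i}"
      proof
        fix p assume p: "p \<in> {i} \<times> {..<d i}"
        then have "p \<in> h ` {1..n}"
          unfolding bij_betw_imp_surj_on[OF h] using i by blast
        then obtain x where "x \<in> {1..n}" "h x = p" by blast
        then show "p \<in> h ` {j\<in>{1..n}. ?f j = i}"
          using p by (intro image_eqI[of _ _ x]) auto
      qed
    qed
    moreover have "inj_on h {j\<in>{1..n}. ?f j = i}"
      using bij_betw_imp_inj_on[OF h] by (rule inj_on_subset) auto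
    ultimately show ?thesis
      using card_image[of h "{j\<in>{1..n}. ?f j = i}"] by (simp add: card_cartesian_product_singleton)
  qed
  ultimately have "?f \<in> funs_deg n d"
    unfolding funs_deg_def by blast
  then show ?thesis by blast
qed

text \<open>Precomposing with a permutation of the vertices permutes each fibre without changing its
  size. This is the exchangeability behind all the counting below.\<close>

lemma funs_deg_transpose:
  assumes "f \<in> funs_deg n d" "a \<in> {1..n}" "b \<in> {1..n}"
  shows "f \<circ> Transposition.transpose a b \<in> funs_deg n d"
proof -
  let ?t = "Transposition.transpose a b"
  have t: "?t x \<in> {1..n} \<longleftrightarrow> x \<in> {1..n}" for x
    using assms(2,3) by (auto simp: Transposition.transpose_def)
  have "card {j\<in>{1..n}. (f \<circ> ?t) j = i} = d i" if i: "i \<in> {1..n}" for i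
  proof -
    have "bij_betw ?t {j\<in>{1..n}. (f \<circ> ?t) j = i} {j\<in>{1..n}. f j = i}"
      by (rule bij_betw_byWitness[where f' = ?t]) (use t in \<open>auto simp del: atLeastAtMost_iff One_nat_def\<close>)
    then have "card {j\<in>{1..n}. (f \<circ> ?t) j = i} = card {j\<in>{1..n}. f j = i}"
      by (rule bij_betw_same_card)
    then show ?thesis
      using funs_deg_fibre[OF assms(1) i] by simp
  qed
  moreover have "f \<circ> ?t \<in> {1..n} \<rightarrow>\<^sub>E {1..n}"
    using assms unfolding funs_deg_def
    by (auto simp: PiE_iff extensional_def Transposition.transpose_def)
  ultimately show ?thesis
    unfolding funs_deg_def by blast
qed

text \<open>No point outside \<open>B\<close> is distinguished, so each of them is equally likely to
  be mapped to \<open>i\<close>.\<close>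

lemma card_next_value:
  assumes S: "S \<subseteq> funs_deg n d" and B: "B \<subseteq> {1..n}" and a: "a \<in> {1..n} - B"
    and closed: "\<And>f b. f \<in> S \<Longrightarrow> b \<in> {1..n} - B \<Longrightarrow> f \<circ> Transposition.transpose a b \<in> S"
    and m: "\<And>f. f \<in> S \<Longrightarrow> card {b\<in>B. f b = i} = m" and i: "i \<in> {1..n}"
  shows "(real n - real (card B)) * real (card {f\<in>S. f a = i}) = (real (d i) - real m) * real (card S)"
proof -
  have finS: "finite S" using S finite_funs_deg finite_subset by blast
  have finB: "finite B" using B finite_subset by blast
  have same: "card {f\<in>S. f b = i} = card {f\<in>S. f a = i}" if b: "b \<in> {1..n} - B" for b
  proof (rule bij_betw_same_card)
    show "bij_betw (\<lambda>f. f \<circ> Transposition.transpose a b) {f\<in>S. f b = i} {f\<in>S. f a = i}"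
      by (rule bij_betw_byWitness[where f' = "\<lambda>f. f \<circ> Transposition.transpose a b"])
        (use closed b in \<open>auto simp: comp_assoc\<close>)
  qed
  have split: "real (card {b\<in>{1..n} - B. f b = i}) = real (d i) - real m" if f: "f \<in> S" for f
  proof -
    have "{j\<in>{1..n}. f j = i} = {b\<in>{1..n} - B. f b = i} \<union> {b\<in>B. f b = i}"
      using B by auto
    moreover have "{b\<in>{1..n} - B. f b = i} \<inter> {b\<in>B. f b = i} = {}" by auto
    ultimately have "card {j\<in>{1..n}. f j = i} = card {b\<in>{1..n} - B. f b = i} + card {b\<in>B. f b = i}"
      using finB by (simp add: card_Un_disjoint)
    then show ?thesis
      using funs_deg_fibre[of f n d i] f S i m[OF f] by auto
  qed
  \<comment> \<open>Count the pairs \<open>(b, f)\<close> with \<open>b\<close> outside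
    \<open>B\<close> and \<open>f b = i\<close> in two ways.\<close>
  have "real (card ({1..n} - B)) * real (card {f\<in>S. f a = i}) = (\<Sum>b\<in>{1..n} - B. real (card {f\<in>S. f b = i}))"
    using same by simp
  also have "\<dots> = (\<Sum>f\<in>S. real (card {b\<in>{1..n} - B. f b = i}))"
    using sum_card_swap[of "{1..n} - B" S "\<lambda>b f. f b = i"] finS
    by (simp flip: of_nat_sum)
  also have "\<dots> = (real (d i) - real m) * real (card S)"
    using split by simp
  finally show ?thesis
    using card_mono[OF _ B] by (simp add: card_Diff_subset[OF finB B] of_nat_diff del: One_nat_def)
qed

section \<open>Orbits as lists, explored one step at a time\<close>

definition orbit :: "('a \<Rightarrow> 'a) \<Rightarrow> 'a \<Rightarrow> nat \<Rightarrow> 'a list" where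
  "orbit f v k = map (\<lambda>j. (f ^^ j) v) [0..<Suc k]"

lemma length_orbit [simp]: "length (orbit f v k) = Suc k"
  by (simp add: orbit_def)

lemma orbit_nth [simp]: "j \<le> k \<Longrightarrow> orbit f v k ! j = (f ^^ j) v"
  by (simp add: orbit_def nth_append del: upt_Suc)

lemma orbit_Suc: "orbit f v (Suc k) = orbit f v k @ [f (last (orbit f v k))]"
  by (simp add: orbit_def)

lemma orbit_0: "orbit f v 0 = [v]"
  by (simp add: orbit_def)

text \<open>The first \<open>k\<close> steps query the function at all orbit points but the last,
  hence the \<open>butlast\<close>.\<close>

lemma orbit_cong:
  assumes "\<And>x. x \<in> set (butlast (orbit f v k)) \<Longrightarrow> g x = f x"
  shows "orbit g v k = orbit f v k"
  using assms
proof (induction k)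
  case (Suc k)
  have 1: "set (butlast (orbit f v (Suc k))) = set (orbit f v k)"
    by (simp add: orbit_Suc)
  have 2: "orbit f v k \<noteq> []" by (metis length_orbit list.size(3) nat.simps(3))
  have "orbit g v k = orbit f v k"
    using Suc.prems by (intro Suc.IH) (auto simp: 1 dest: in_set_butlastD)
  with 1 2 Suc.prems show ?case by (simp add: orbit_Suc)
qed (simp add: orbit_0)

text \<open>One exploration step: given the orbit so far, the image of its last point is governed by
  the preimages of \<open>i\<close> not yet used up, spread over the \<open>n - k\<close> points
  whose images are still unknown. Stated without division, so no conditional probability has to be
  defined.\<close>

lemma card_orbit_step:
  assumes ys: "distinct ys" "length ys = Suc k" "set ys \<subseteq> {1..n}" and i: "i \<in> {1..n}"
  shows "(real n - real k) * real (card {f\<in>funs_deg n d. orbit f v k = ys \<and> f (last ys) = i})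
    = (real (d i) - of_bool (i \<in> set (tl ys))) * real (card {f\<in>funs_deg n d. orbit f v k = ys})"
proof -
  let ?S = "{f\<in>funs_deg n d. orbit f v k = ys}" and ?B = "set (butlast ys)"
  have ne: "ys \<noteq> []" using ys by auto
  have cB: "card ?B = k"
    using ys by (simp add: distinct_card distinct_butlast)
  have B: "?B \<subseteq> {1..n}" using ys(3) by (auto dest: in_set_butlastD)
  have a: "last ys \<in> {1..n} - ?B"
    using ne ys(1,3) by (cases ys rule: rev_cases) auto
  have nth_B: "\<And>b. b \<in> ?B \<longleftrightarrow> (\<exists>j<k. b = ys ! j)"
    using ys(2) by (auto simp: in_set_conv_nth nth_butlast)
  \<comment> \<open>Both \<open>last ys\<close> and \<open>b\<close> lie outside the queried points,
    so swapping their values leaves the orbit unchanged.\<close>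
  have closed: "f \<circ> Transposition.transpose (last ys) b \<in> ?S" if f: "f \<in> ?S" and b: "b \<in> {1..n} - ?B" for f b
  proof -
    have "orbit (f \<circ> Transposition.transpose (last ys) b) v k = orbit f v k"
      using a b f by (intro orbit_cong) (auto simp: Transposition.transpose_def)
    then show ?thesis
      using a b f funs_deg_transpose[of f n d "last ys" b] by auto
  qed
  \<comment> \<open>The queried points are mapped bijectively onto \<open>tl ys\<close>. The start
    is not in \<open>tl ys\<close>, so a return to it still has full weight \<open>d v\<close>,
    whereas a return to any later orbit point has weight one less than its degree.\<close>
  have m: "card {b\<in>?B. f b = i} = of_bool (i \<in> set (tl ys))" if f: "f \<in> ?S" for f
  proof -
    have step: "f (ys ! j) = ys ! Suc j" if "j < k" for j
    proof -
      have "orbit f v k = ys" using f by simp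
      then have "ys ! j = (f ^^ j) v" "ys ! Suc j = (f ^^ Suc j) v"
        using orbit_nth[of j k f v] orbit_nth[of "Suc j" k f v] that by auto
      then show ?thesis by simp
    qed
    have tl: "i \<in> set (tl ys) \<longleftrightarrow> (\<exists>j<k. i = ys ! Suc j)"
      using ys(2) by (auto simp: in_set_conv_nth nth_tl)
    show ?thesis
    proof (cases "i \<in> set (tl ys)")
      case True
      then obtain j where j: "j < k" "i = ys ! Suc j" using tl by blast
      have "{b\<in>?B. f b = i} = {ys ! j}"
        using j ys(1,2) by (auto simp: nth_B step nth_eq_iff_index_eq)
      then show ?thesis using True by simp
    next
      case False
      then have "{b\<in>?B. f b = i} = {}" using tl by (auto simp: nth_B step)
      then show ?thesis using False by simp
    qed
  qed
  have "{f\<in>?S. f (last ys) = i} = {f\<in>funs_deg n d. orbit f v k = ys \<and> f (last ys) = i}" by auto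
  with card_next_value[OF _ B a closed m i, of d] show ?thesis
    by (simp add: cB)
qed

definition falling :: "nat \<Rightarrow> nat \<Rightarrow> real" where
  "falling n k = (\<Prod>i<k. real n - real i)"

text \<open>Chain rule for the exploration: each new vertex is not yet in the tail of the orbit, so
  \<open>card_orbit_step\<close> contributes its full degree, and the denominators multiply up to
  the falling factorial.\<close>

lemma card_orbit_eq:
  assumes "distinct (v # xs)" "set (v # xs) \<subseteq> {1..n}"
  shows "falling n (length xs) * real (card {f\<in>funs_deg n d. orbit f v (length xs) = v # xs})
    = prod_list (map (\<lambda>i. real (d i)) xs) * real (card (funs_deg n d))"
  using assms
proof (induction xs rule: rev_induct)
  case Nil
  then show ?case by (simp add: falling_def orbit_0)
next
  case (snoc x xs)
  let ?k = "length xs" and ?ys = "v # xs"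
  have eq: "{f\<in>funs_deg n d. orbit f v (length (xs @ [x])) = v # xs @ [x]}
      = {f\<in>funs_deg n d. orbit f v ?k = ?ys \<and> f (last ?ys) = x}"
    by (auto simp: orbit_Suc simp flip: append_Cons)
  let ?N = "\<lambda>P. real (card {f\<in>funs_deg n d. P f})"
  have "falling n (Suc ?k) * ?N (\<lambda>f. orbit f v ?k = ?ys \<and> f (last ?ys) = x)
      = falling n ?k * ((real n - real ?k) * ?N (\<lambda>f. orbit f v ?k = ?ys \<and> f (last ?ys) = x))"
    by (simp add: falling_def)
  also have "(real n - real ?k) * ?N (\<lambda>f. orbit f v ?k = ?ys \<and> f (last ?ys) = x)
      = real (d x) * ?N (\<lambda>f. orbit f v ?k = ?ys)"
    using snoc.prems card_orbit_step[of ?ys ?k n x d v] by auto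
  also have "falling n ?k * (real (d x) * ?N (\<lambda>f. orbit f v ?k = ?ys))
      = real (d x) * (falling n ?k * ?N (\<lambda>f. orbit f v ?k = ?ys))"
    by simp
  also have "falling n ?k * ?N (\<lambda>f. orbit f v ?k = ?ys)
      = prod_list (map (\<lambda>i. real (d i)) xs) * real (card (funs_deg n d))"
    using snoc by auto
  finally show ?case
    unfolding eq by simp
qed

subsection \<open>The joint law of six-length and tail-length\<close>

lemma set_orbit: "set (orbit f v k) = {(f ^^ j) v |j. j \<le> k}"
  unfolding orbit_def by (auto simp del: upt_Suc)

lemma rho_tail_len_eq:
  assumes dist: "distinct (orbit f v k)" and j: "j \<le> k" and eq: "(f ^^ Suc k) v = (f ^^ j) v"
  shows "rho_len f v = Suc k" "tail_len f v = j"
proof -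
  have inj: "(f ^^ a) v = (f ^^ b) v \<longleftrightarrow> a = b" if "a \<le> k" "b \<le> k" for a b
    using nth_eq_iff_index_eq[OF dist, of a b] that by simp
  show rho: "rho_len f v = Suc k"
    unfolding rho_len_def
  proof (rule Least_equality)
    show "1 \<le> Suc k \<and> (f ^^ Suc k) v \<in> {(f ^^ j) v |j. j \<le> Suc k - 1}"
      using j eq by auto
  next
    fix m assume m: "1 \<le> m \<and> (f ^^ m) v \<in> {(f ^^ j) v |j. j \<le> m - 1}"
    then obtain i where i: "i \<le> m - 1" "(f ^^ m) v = (f ^^ i) v" by blast
    show "Suc k \<le> m"
    proof (rule ccontr)
      assume "\<not> Suc k \<le> m"
      then have "m \<le> k" "i \<le> k" using i by auto
      then show False using inj[of m i] i m by auto
    qed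
  qed
  show "tail_len f v = j"
    unfolding tail_len_def rho
  proof (rule the_equality)
    show "j < Suc k \<and> (f ^^ Suc k) v = (f ^^ j) v" using j eq by simp
  next
    fix t assume "t < Suc k \<and> (f ^^ Suc k) v = (f ^^ t) v"
    then show "t = j" using inj[of t j] j eq by auto
  qed
qed

lemma orbit_in:
  assumes "f ` A \<subseteq> A" "v \<in> A"
  shows "set (orbit f v k) \<subseteq> A"
proof -
  have "(f ^^ j) v \<in> A" for j by (induction j) (use assms in auto)
  then show ?thesis by (auto simp: set_orbit)
qed

text \<open>Pigeonhole: \<open>card A + 1\<close> points of \<open>A\<close> cannot be
  distinct.\<close>

lemma first_repeat_exists:
  assumes f: "f ` A \<subseteq> A" and v: "v \<in> A" and A: "finite A"
  obtains k j where "k < card A" "j \<le> k" "distinct (orbit f v k)" "(f ^^ Suc k) v = (f ^^ j) v"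
proof -
  have "\<not> distinct (orbit f v (card A))"
    using card_mono[OF A orbit_in[OF f v, of "card A"]] distinct_card[of "orbit f v (card A)"] by auto
  \<comment> \<open>\<open>m\<close> is the least time at which the orbit list fails to be distinct.
    It is a successor because the orbit at time 0 is a singleton.\<close>
  then obtain m where m: "\<not> distinct (orbit f v m)" "m \<le> card A" "\<And>i. i < m \<Longrightarrow> distinct (orbit f v i)"
    using that[of "LEAST m. \<not> distinct (orbit f v m)"] not_less_Least[of _ "\<lambda>m. \<not> distinct (orbit f v m)"]
      LeastI[of "\<lambda>m. \<not> distinct (orbit f v m)" "card A"]
      Least_le[of "\<lambda>m. \<not> distinct (orbit f v m)" "card A"] by blast
  then obtain k where k: "m = Suc k" by (cases m) (auto simp: orbit_0)
  then have "distinct (orbit f v k)" using m by simp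
  moreover have "orbit f v (Suc k) = orbit f v k @ [(f ^^ Suc k) v]" by (simp add: orbit_def)
  ultimately have "(f ^^ Suc k) v \<in> set (orbit f v k)" using m(1) k by auto
  then obtain j where "j \<le> k" "(f ^^ Suc k) v = (f ^^ j) v" by (auto simp: set_orbit)
  with \<open>distinct (orbit f v k)\<close> k m(2) show thesis by (intro that[of k j]) auto
qed

lemma rho_tail_len_iff:
  assumes f: "f ` A \<subseteq> A" and v: "v \<in> A" and A: "finite A" and j: "j \<le> k"
  shows "rho_len f v = Suc k \<and> tail_len f v = j \<longleftrightarrow>
    distinct (orbit f v k) \<and> (f ^^ Suc k) v = (f ^^ j) v"
proof
  assume *: "rho_len f v = Suc k \<and> tail_len f v = j"
  obtain m i where mi: "i \<le> m" "distinct (orbit f v m)" "(f ^^ Suc m) v = (f ^^ i) v"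
    using first_repeat_exists[OF f v A] by blast
  have "m = k" "i = j"
    using rho_tail_len_eq[OF mi(2,1,3)] * by simp_all
  then show "distinct (orbit f v k) \<and> (f ^^ Suc k) v = (f ^^ j) v" using mi(2,3) by simp
next
  assume *: "distinct (orbit f v k) \<and> (f ^^ Suc k) v = (f ^^ j) v"
  show "rho_len f v = Suc k \<and> tail_len f v = j"
    using rho_tail_len_eq[OF conjunct1[OF *] j conjunct2[OF *]] by simp
qed

lemma rho_tail_len_exist:
  assumes f: "f ` A \<subseteq> A" and v: "v \<in> A" and A: "finite A"
  shows "\<exists>k j. k < card A \<and> j \<le> k \<and> rho_len f v = Suc k \<and> tail_len f v = j"
proof -
  obtain m i where mi: "m < card A" "i \<le> m" "distinct (orbit f v m)" "(f ^^ Suc m) v = (f ^^ i) v"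
    using first_repeat_exists[OF f v A] by blast
  with rho_tail_len_eq[OF mi(3,2,4)] show ?thesis by blast
qed

text \<open>Here \<open>i\<close> is the vertex that the orbit hits again: it carries
  \<open>d i\<close> for the first visit and \<open>d i - 1\<close> for the second, and
  \<open>wsum\<close> covers the other \<open>k - 1\<close> vertices. At \<open>k = 0\<close> the
  truncated \<open>k - 1\<close> does no harm, since \<open>coll_prob\<close> has the factor
  \<open>k\<close>.\<close>

definition tail_weight :: "nat \<Rightarrow> (nat \<Rightarrow> nat) \<Rightarrow> nat \<Rightarrow> nat \<Rightarrow> real" where
  "tail_weight n d v k = (\<Sum>i\<in>{1..n} - {v}.
     (real (d i) - 1) * real (d i) * wsum (\<lambda>i. real (d i)) (k - 1) ({1..n} - {v} - {i}))"

text \<open>Sum over the trajectory \<open>xs\<close> that follows \<open>v\<close>: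
  \<open>card_orbit_eq\<close> weighs the trajectory and \<open>card_orbit_step\<close> the closing
  step. The count is independent of \<open>j\<close> by \<open>sum_inj_lists_marked\<close>. The
  case \<open>j = 0\<close> is excluded because a return to \<open>v\<close> has weight
  \<open>d v\<close>, not \<open>d v - 1\<close>.\<close>

lemma card_rho_tail:
  assumes v: "v \<in> {1..n}" and j: "1 \<le> j" "j \<le> k"
  shows "falling n (Suc k) * real (card {f\<in>funs_deg n d. rho_len f v = Suc k \<and> tail_len f v = j})
    = tail_weight n d v k * real (card (funs_deg n d))"
proof -
  let ?S = "{1..n} - {v}" and ?F = "funs_deg n d"
  let ?w = "\<lambda>i. real (d i)"
  obtain m where k: "k = Suc m" using j by (cases k) auto
  \<comment> \<open>The index is \<open>j - 1\<close> because \<open>xs\<close> omits the starting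
    point \<open>v\<close>.\<close>
  let ?E = "\<lambda>xs. {f\<in>?F. orbit f v k = v # xs \<and> f (last (v # xs)) = xs ! (j - 1)}"
  have "{f\<in>?F. rho_len f v = Suc k \<and> tail_len f v = j}
      = {f\<in>?F. distinct (orbit f v k) \<and> (f ^^ Suc k) v = (f ^^ j) v}"
    by (intro Collect_cong conj_cong refl
        rho_tail_len_iff[OF funs_deg_image v finite_atLeastAtMost j(2)])
  also have "\<dots> = (\<Union>xs\<in>inj_lists k ?S. ?E xs)"
  proof (intro equalityI subsetI)
    fix f assume f: "f \<in> {f\<in>?F. distinct (orbit f v k) \<and> (f ^^ Suc k) v = (f ^^ j) v}"
    obtain y xs where ys: "orbit f v k = y # xs" by (metis length_orbit length_Suc_conv)
    have y: "y = v" using orbit_nth[of 0 k f v] ys by simp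
    have sub: "set (orbit f v k) \<subseteq> {1..n}"
      using f v by (intro orbit_in funs_deg_image[of f n d]) simp_all
    have dist: "distinct (v # xs)" and F: "f \<in> ?F"
      using f ys y by simp_all
    have "xs \<in> inj_lists k ?S"
      using dist sub length_orbit[of f v k] unfolding ys y inj_lists_def by auto
    moreover have "last (orbit f v k) = (f ^^ k) v"
      by (simp add: orbit_def)
    moreover have "xs ! (j - 1) = (f ^^ j) v"
      using orbit_nth[of j k f v] ys j by (simp add: nth_Cons')
    ultimately show "f \<in> (\<Union>xs\<in>inj_lists k ?S. ?E xs)"
      using f F ys y by auto
  next
    fix f assume "f \<in> (\<Union>xs\<in>inj_lists k ?S. ?E xs)"
    then obtain xs where xs: "xs \<in> inj_lists k ?S" and f: "f \<in> ?E xs" by blast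
    then have o: "orbit f v k = v # xs" by simp
    have "last (orbit f v k) = (f ^^ k) v"
      by (simp add: orbit_def)
    moreover have "xs ! (j - 1) = (f ^^ j) v"
      using orbit_nth[of j k f v] o j by (simp add: nth_Cons')
    moreover have "distinct (v # xs)" using xs by (auto simp: inj_lists_def)
    ultimately show "f \<in> {f\<in>?F. distinct (orbit f v k) \<and> (f ^^ Suc k) v = (f ^^ j) v}"
      using f o by simp
  qed
  finally have union: "{f\<in>?F. rho_len f v = Suc k \<and> tail_len f v = j} = (\<Union>xs\<in>inj_lists k ?S. ?E xs)" .
  have "card {f\<in>?F. rho_len f v = Suc k \<and> tail_len f v = j} = (\<Sum>xs\<in>inj_lists k ?S. card (?E xs))"
    unfolding union
  proof (intro card_UN_disjoint ballI impI finite_inj_lists)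
    fix xs ys :: "nat list" assume "xs \<noteq> ys"
    then show "?E xs \<inter> ?E ys = {}" by auto
  qed (auto simp: finite_funs_deg)
  then have "falling n (Suc k) * real (card {f\<in>?F. rho_len f v = Suc k \<and> tail_len f v = j})
      = (\<Sum>xs\<in>inj_lists k ?S. falling n (Suc k) * real (card (?E xs)))"
    by (simp add: sum_distrib_left)
  also have "\<dots> = (\<Sum>xs\<in>inj_lists k ?S. (?w (xs ! (j - 1)) - 1) * prod_list (map ?w xs) * real (card ?F))"
  proof (intro sum.cong refl)
    fix xs assume xs: "xs \<in> inj_lists k ?S"
    then have len: "length xs = k" and d: "distinct (v # xs)" and s: "set (v # xs) \<subseteq> {1..n}"
      using v by (auto simp: inj_lists_def)
    have mem: "xs ! (j - 1) \<in> set xs" using len j by auto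
    have "(real n - real k) * real (card (?E xs))
        = (?w (xs ! (j - 1)) - 1) * real (card {f\<in>?F. orbit f v k = v # xs})"
      using card_orbit_step[OF d _ s, of k "xs ! (j - 1)" d v] len mem s by auto
    then have "falling n (Suc k) * real (card (?E xs))
        = (?w (xs ! (j - 1)) - 1) * (falling n k * real (card {f\<in>?F. orbit f v k = v # xs}))"
      by (simp add: falling_def mult_ac)
    also have "falling n k * real (card {f\<in>?F. orbit f v k = v # xs}) = prod_list (map ?w xs) * real (card ?F)"
      using card_orbit_eq[OF d s, of d] len by simp
    finally show "falling n (Suc k) * real (card (?E xs))
        = (?w (xs ! (j - 1)) - 1) * prod_list (map ?w xs) * real (card ?F)" by simp
  qed
  also have "\<dots> = (\<Sum>xs\<in>inj_lists k ?S. (?w (xs ! (j - 1)) - 1) * prod_list (map ?w xs)) * real (card ?F)"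
    by (simp add: sum_distrib_right)
  also have "(\<Sum>xs\<in>inj_lists k ?S. (?w (xs ! (j - 1)) - 1) * prod_list (map ?w xs)) = tail_weight n d v k"
    unfolding k tail_weight_def using j k
    by (subst sum_inj_lists_marked) auto
  finally show ?thesis .
qed

lemma falling_Suc: "falling n (Suc k) = (real n - real k) * falling n k"
  by (simp add: falling_def)

lemma falling_pos: "k \<le> n \<Longrightarrow> falling n k > 0"
  unfolding falling_def by (intro prod_pos) auto

text \<open>The probability that the six-length is \<open>k + 1\<close> and the tail-length is positive.\<close>

definition coll_prob :: "nat \<Rightarrow> (nat \<Rightarrow> nat) \<Rightarrow> nat \<Rightarrow> nat \<Rightarrow> real" where
  "coll_prob n d v k = real k * tail_weight n d v k / falling n (Suc k)"

text \<open>On positive tails the law is known exactly: mass \<open>coll_prob\<close> at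
  \<open>k\<close>, spread evenly over the \<open>k\<close> tail-lengths. Tail-length 0 is not
  computed; its total mass is whatever remains of 1, and \<open>M\<close> times that mass bounds its
  contribution. For \<open>k = 0\<close> the average is \<open>0 / 0 = 0\<close> and
  \<open>coll_prob\<close> vanishes.\<close>

lemma expectation_rho_tail:
  fixes h :: "nat \<Rightarrow> nat \<Rightarrow> real"
  assumes deg: "degree_seq n d" and v: "v \<in> {1..n}" and h: "\<And>a b. \<bar>h a b\<bar> \<le> M"
  shows "\<bar>measure_pmf.expectation (pmf_of_set (funs_deg n d)) (\<lambda>f. h (rho_len f v) (tail_len f v))
      - (\<Sum>k<n. coll_prob n d v k * ((\<Sum>j<k. h (Suc k) (Suc j)) / real k))\<bar>
    \<le> M * (1 - (\<Sum>k<n. coll_prob n d v k))"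
proof -
  let ?F = "funs_deg n d"
  define N where "N = real (card ?F)"
  define e where "e k j = real (card {f\<in>?F. rho_len f v = Suc k \<and> tail_len f v = j}) / N" for k j
  have ne: "?F \<noteq> {}" using funs_deg_nonempty[OF deg] .
  have N: "N > 0" using ne finite_funs_deg by (simp add: N_def card_gt_0_iff)
  \<comment> \<open>Group the functions by the pair of their lengths; \<open>e\<close> is the joint
    probability mass function, with the six-length shifted by one.\<close>
  have ex: "measure_pmf.expectation (pmf_of_set ?F) (\<lambda>f. g (rho_len f v) (tail_len f v))
      = (\<Sum>k<n. \<Sum>j<Suc k. e k j * g (Suc k) j)" for g :: "nat \<Rightarrow> nat \<Rightarrow> real"
  proof -
    let ?I = "Sigma {..<n} (\<lambda>k. {..<Suc k})"
    let ?\<phi> = "\<lambda>f. (rho_len f v - 1, tail_len f v)"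
    have mem: "?\<phi> f \<in> ?I" "rho_len f v = Suc (rho_len f v - 1)" if "f \<in> ?F" for f
      using rho_tail_len_exist[where A = "{1..n}", OF funs_deg_image[OF that] v] by auto
    have "(\<Sum>f\<in>?F. g (rho_len f v) (tail_len f v))
        = (\<Sum>p\<in>?I. \<Sum>f\<in>{f\<in>?F. ?\<phi> f = p}. g (rho_len f v) (tail_len f v))"
      using mem by (intro sum.group[symmetric] finite_funs_deg) auto
    also have "\<dots> = (\<Sum>p\<in>?I. N * (e (fst p) (snd p) * g (Suc (fst p)) (snd p)))"
    proof (intro sum.cong refl)
      fix p assume "p \<in> ?I"
      have eq: "{f\<in>?F. ?\<phi> f = p} = {f\<in>?F. rho_len f v = Suc (fst p) \<and> tail_len f v = snd p}"
        using mem(2) by force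
      then show "(\<Sum>f\<in>{f\<in>?F. ?\<phi> f = p}. g (rho_len f v) (tail_len f v))
          = N * (e (fst p) (snd p) * g (Suc (fst p)) (snd p))"
        unfolding eq e_def using N by simp
    qed
    also have "\<dots> = N * (\<Sum>k<n. \<Sum>j<Suc k. e k j * g (Suc k) j)"
      by (simp add: sum.Sigma split_def sum_distrib_left del: sum.lessThan_Suc)
    finally show ?thesis
      using integral_pmf_of_set[OF ne finite_funs_deg, of "\<lambda>f. g (rho_len f v) (tail_len f v)"] N
      by (simp add: N_def)
  qed
  have e_eq: "e k (Suc j) = coll_prob n d v k / real k" if "j < k" "k < n" for j k
    using card_rho_tail[OF v, of "Suc j" k d] falling_pos[of "Suc k" n] N that
    by (simp add: e_def coll_prob_def N_def field_simps)
  have coll: "(\<Sum>j<k. e k (Suc j)) = coll_prob n d v k" if "k < n" for k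
    using e_eq[of _ k] that by (cases "k = 0") (auto simp: coll_prob_def)
  \<comment> \<open>The constant test function 1 yields the total mass, from which the mass at
    tail-length 0 is read off.\<close>
  have "(\<Sum>k<n. \<Sum>j<Suc k. e k j) = 1"
    using ex[of "\<lambda>_ _. 1"] by simp
  then have e0: "(\<Sum>k<n. e k 0) = 1 - (\<Sum>k<n. coll_prob n d v k)"
    by (simp add: sum.lessThan_Suc_shift sum.distrib coll del: sum.lessThan_Suc)
  have inner: "(\<Sum>k<n. coll_prob n d v k * ((\<Sum>j<k. h (Suc k) (Suc j)) / real k))
      = (\<Sum>k<n. \<Sum>j<k. e k (Suc j) * h (Suc k) (Suc j))"
    by (intro sum.cong refl) (simp add: e_eq sum_distrib_left sum_divide_distrib)
  have "measure_pmf.expectation (pmf_of_set ?F) (\<lambda>f. h (rho_len f v) (tail_len f v))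
      - (\<Sum>k<n. coll_prob n d v k * ((\<Sum>j<k. h (Suc k) (Suc j)) / real k))
      = (\<Sum>k<n. e k 0 * h (Suc k) 0)"
    unfolding ex inner by (simp add: sum.lessThan_Suc_shift sum.distrib del: sum.lessThan_Suc)
  also have "\<bar>\<dots>\<bar> \<le> (\<Sum>k<n. M * e k 0)"
  proof (rule order_trans[OF sum_abs], intro sum_mono)
    fix k
    have "e k 0 \<ge> 0" using N by (simp add: e_def)
    then show "\<bar>e k 0 * h (Suc k) 0\<bar> \<le> M * e k 0"
      using mult_left_mono[OF h[of "Suc k" 0], of "e k 0"] by (simp add: abs_mult mult.commute)
  qed
  also have "\<dots> = M * (1 - (\<Sum>k<n. coll_prob n d v k))"
    by (simp add: e0 flip: sum_distrib_left)
  finally show ?thesis .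
qed

subsection \<open>Hazard bounds\<close>

text \<open>By \<open>card_orbit_eq\<close>, this is for \<open>k \<le> n\<close> the probability
  that the first \<open>k\<close> steps visit new vertices only, that is, that the six-length
  exceeds \<open>k\<close>.\<close>

definition surv :: "nat \<Rightarrow> (nat \<Rightarrow> nat) \<Rightarrow> nat \<Rightarrow> nat \<Rightarrow> real" where
  "surv n d v k = wsum (\<lambda>i. real (d i)) k ({1..n} - {v}) / falling n k"

definition excess :: "nat \<Rightarrow> (nat \<Rightarrow> nat) \<Rightarrow> nat \<Rightarrow> real" where
  "excess n d v = (\<Sum>i\<in>{1..n} - {v}. (real (d i) - 1) * real (d i))"

lemma pred_mult_nonneg: "(real m - 1) * real m \<ge> 0"
  by (cases m) auto

lemma excess_nonneg: "excess n d v \<ge> 0"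
  unfolding excess_def by (intro sum_nonneg pred_mult_nonneg)

lemma sum_degree_remove:
  assumes "degree_seq n d" "v \<in> {1..n}"
  shows "(\<Sum>i\<in>{1..n} - {v}. real (d i)) = real n - real (d v)"
proof -
  have "(\<Sum>i\<in>{1..n}. real (d i)) = real n"
    using assms(1) unfolding degree_seq_def by (simp flip: of_nat_sum)
  then show ?thesis using assms(2) by (simp add: sum_diff1)
qed

lemma excess_eq:
  assumes "degree_seq n d" "v \<in> {1..n}"
  shows "excess n d v = real n * sigma2 n d - (real (d v) - 1) * real (d v)"
proof -
  have n: "n > 0" using assms(2) by auto
  have "(\<Sum>i\<in>{1..n}. real (d i)) = real n"
    using assms(1) unfolding degree_seq_def by (simp flip: of_nat_sum)
  then have "(\<Sum>i\<in>{1..n}. (real (d i) - 1) * real (d i)) = real (moment 2 n d) - real n"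
    by (simp add: moment_def left_diff_distrib sum_subtractf power2_eq_square)
  also have "\<dots> = real n * sigma2 n d"
    using n by (simp add: sigma2_def field_simps)
  finally show ?thesis
    using assms(2) by (simp add: excess_def sum_diff1)
qed

lemma le_max_deg: "i \<in> {1..n} \<Longrightarrow> d i \<le> max_deg n d"
  unfolding max_deg_def by (intro Max_ge) auto

lemma tail_weight_nonneg: "tail_weight n d v k \<ge> 0"
  unfolding tail_weight_def by (intro sum_nonneg mult_nonneg_nonneg pred_mult_nonneg wsum_nonneg) auto

lemma coll_prob_nonneg: "k < n \<Longrightarrow> coll_prob n d v k \<ge> 0"
  unfolding coll_prob_def
  by (intro divide_nonneg_pos mult_nonneg_nonneg tail_weight_nonneg falling_pos) auto

lemma surv_nonneg: "k \<le> n \<Longrightarrow> surv n d v k \<ge> 0"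
  unfolding surv_def by (intro divide_nonneg_pos wsum_nonneg falling_pos) auto

lemma surv_0: "surv n d v 0 = 1"
  by (simp add: surv_def wsum_0 falling_def)

text \<open>Survival is lost at step \<open>k\<close> in two ways: by a return to \<open>v\<close>,
  at rate \<open>d v / (n - k)\<close>, or by a repetition with positive tail, with probability
  \<open>coll_prob\<close>. The proof is algebraic, through \<open>wsum_Suc_Suc\<close>.\<close>

lemma surv_Suc:
  assumes deg: "degree_seq n d" and v: "v \<in> {1..n}" and k: "k < n"
  shows "surv n d v (Suc k)
    = (1 - real (d v) / (real n - real k)) * surv n d v k - coll_prob n d v k"
proof -
  let ?S = "{1..n} - {v}" and ?w = "\<lambda>i. real (d i)"
  have fin: "finite ?S" by simp
  have pos: "falling n k > 0" "falling n (Suc k) > 0" "real n - real k > 0"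
    using k by (auto intro!: falling_pos)
  have rec: "wsum ?w (Suc k) ?S = (real n - real (d v) - real k) * wsum ?w k ?S - real k * tail_weight n d v k"
  proof (cases k)
    case 0
    then show ?thesis using sum_degree_remove[OF deg v] by (simp add: wsum_Suc wsum_0)
  next
    case (Suc m)
    \<comment> \<open>Split each squared degree \<open>d i * d i\<close> as
      \<open>(d i - 1) * d i + d i\<close>.\<close>
    have "(\<Sum>i\<in>?S. ?w i * ?w i * wsum ?w m (?S - {i})) = tail_weight n d v (Suc m) + wsum ?w (Suc m) ?S"
      by (simp add: tail_weight_def wsum_Suc algebra_simps sum_subtractf)
    then show ?thesis
      unfolding Suc wsum_Suc_Suc[OF fin] sum_degree_remove[OF deg v] by (simp add: algebra_simps)
  qed
  have "surv n d v (Suc k) = (real n - real (d v) - real k) * wsum ?w k ?S / falling n (Suc k) - coll_prob n d v k"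
    unfolding surv_def coll_prob_def rec by (simp add: diff_divide_distrib)
  also have "(real n - real (d v) - real k) * wsum ?w k ?S / falling n (Suc k)
      = (1 - real (d v) / (real n - real k)) * surv n d v k"
    using pos by (simp add: surv_def falling_Suc field_simps)
  finally show ?thesis .
qed

text \<open>The vertex \<open>v\<close> and the \<open>m\<close> chosen vertices are at most
  \<open>k\<close> in number, so they remove at most \<open>k * max_deg n d\<close> from the total
  degree \<open>n\<close>.\<close>

lemma wsum_degree_Suc_ge:
  assumes deg: "degree_seq n d" and v: "v \<in> {1..n}" and m: "m < k"
  shows "(real n - real k * real (max_deg n d)) * wsum (\<lambda>i. real (d i)) m ({1..n} - {v})
    \<le> wsum (\<lambda>i. real (d i)) (Suc m) ({1..n} - {v})"
proof -
  let ?S = "{1..n} - {v}" and ?w = "\<lambda>i. real (d i)" and ?D = "real (max_deg n d)"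
  have "real (Suc m) * ?D \<le> real k * ?D" using m by (intro mult_right_mono) auto
  moreover have "?w v \<le> ?D" using le_max_deg[OF v, of d] by simp
  ultimately have "real n - real k * ?D \<le> sum ?w ?S - real m * ?D"
    unfolding sum_degree_remove[OF deg v] by (simp add: algebra_simps)
  then have "(real n - real k * ?D) * wsum ?w m ?S \<le> (sum ?w ?S - real m * ?D) * wsum ?w m ?S"
    by (intro mult_right_mono wsum_nonneg) auto
  also have "\<dots> \<le> wsum ?w (Suc m) ?S"
    using le_max_deg[of _ n d] by (intro wsum_Suc_ge) auto
  finally show ?thesis .
qed

text \<open>Ignore the deletion of \<open>i\<close> in \<open>tail_weight\<close>, then lengthen the
  lists from \<open>k - 1\<close> to \<open>k\<close> at the cost of the factor from
  \<open>wsum_degree_Suc_ge\<close>, so that \<open>surv\<close> appears. The coefficient depends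
  only on the horizon \<open>K\<close>, as the recursions below require.\<close>

lemma coll_prob_le:
  assumes deg: "degree_seq n d" and v: "v \<in> {1..n}" and k: "k \<le> K" "K < n"
    and K: "real K * real (max_deg n d) < real n"
  shows "coll_prob n d v k
    \<le> excess n d v / ((real n - real K * real (max_deg n d)) * (real n - real K)) * real k * surv n d v k"
proof (cases k)
  case 0
  then show ?thesis by (simp add: coll_prob_def)
next
  case (Suc m)
  let ?S = "{1..n} - {v}" and ?w = "\<lambda>i. real (d i)" and ?D = "real (max_deg n d)" and ?A = "excess n d v"
  have pos: "real n - real K * ?D > 0" "real n - real K > 0" using k K by auto
  have fpos: "falling n k > 0" using k by (intro falling_pos) auto
  have "tail_weight n d v k \<le> ?A * wsum ?w m ?S"
    unfolding tail_weight_def excess_def sum_distrib_right Suc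
    by (intro sum_mono mult_left_mono pred_mult_nonneg) (auto intro!: wsum_mono)
  then have "(real n - real K * ?D) * tail_weight n d v k \<le> ?A * ((real n - real K * ?D) * wsum ?w m ?S)"
    using pos by (simp add: mult.left_commute)
  also have "\<dots> \<le> ?A * wsum ?w k ?S"
    unfolding Suc using Suc k by (intro mult_left_mono excess_nonneg wsum_degree_Suc_ge deg v) auto
  finally have 1: "tail_weight n d v k \<le> ?A * wsum ?w k ?S / (real n - real K * ?D)"
    using pos by (simp add: field_simps)
  have "coll_prob n d v k = real k * tail_weight n d v k / ((real n - real k) * falling n k)"
    by (simp add: coll_prob_def falling_Suc)
  also have "\<dots> \<le> real k * tail_weight n d v k / ((real n - real K) * falling n k)"
    using pos k fpos tail_weight_nonneg
    by (intro divide_left_mono mult_right_mono mult_nonneg_nonneg mult_pos_pos) auto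
  also have "\<dots> \<le> real k * (?A * wsum ?w k ?S / (real n - real K * ?D)) / ((real n - real K) * falling n k)"
    using pos fpos 1 by (intro divide_right_mono mult_left_mono) auto
  also have "\<dots> = ?A / ((real n - real K * ?D) * (real n - real K)) * real k * surv n d v k"
    by (simp add: surv_def mult_ac)
  finally show ?thesis .
qed

text \<open>Here the deletion of \<open>i\<close> must be paid for: by \<open>wsum_remove\<close> it
  costs at most the fraction \<delta> of the weight. Assuming \<open>2 * K * max_deg \<le> n\<close>
  keeps \<delta> at most 1.\<close>

lemma coll_prob_ge:
  assumes deg: "degree_seq n d" and v: "v \<in> {1..n}" and k: "k \<le> K" "K < n"
    and K: "2 * (real K * real (max_deg n d)) \<le> real n"
  shows "excess n d v / (real n)\<^sup>2
        * (1 - real K * real (max_deg n d) / (real n - real K * real (max_deg n d))) * real k * surv n d v k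
    \<le> coll_prob n d v k"
proof (cases k)
  case 0
  then show ?thesis by (simp add: coll_prob_def)
next
  case (Suc m)
  let ?S = "{1..n} - {v}" and ?w = "\<lambda>i. real (d i)" and ?D = "real (max_deg n d)" and ?A = "excess n d v"
  define \<delta> where "\<delta> = real K * ?D / (real n - real K * ?D)"
  have n: "real n > 0" using v by auto
  have pos: "real n - real K * ?D > 0" using K n by linarith
  have \<delta>: "1 - \<delta> \<ge> 0" using pos K by (simp add: \<delta>_def field_simps)
  have npos: "real n - real k > 0" using k by auto
  have fpos: "falling n k > 0" using k by (intro falling_pos) auto
  have fin: "finite ?S" by simp
  have rem: "(1 - \<delta>) * wsum ?w m ?S \<le> wsum ?w m (?S - {i})" if i: "i \<in> ?S" for i
  proof (cases m)
    case 0
    have "\<delta> \<ge> 0" using pos by (simp add: \<delta>_def)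
    then show ?thesis by (simp add: 0 wsum_0)
  next
    case (Suc l)
    \<comment> \<open>The left side is exactly the loss in \<open>wsum_remove\<close>; the lists of
      length \<open>l\<close> on the right are then lengthened to length \<open>m\<close>.\<close>
    have "real (Suc l) * ?w i * wsum ?w l (?S - {i}) \<le> real K * ?D * wsum ?w l ?S"
      using le_max_deg[of i n d] i k Suc \<open>k = Suc m\<close>
      by (intro mult_mono wsum_mono wsum_nonneg mult_nonneg_nonneg) auto
    also have "\<dots> = \<delta> * ((real n - real K * ?D) * wsum ?w l ?S)"
      using pos by (simp add: \<delta>_def)
    also have "\<dots> \<le> \<delta> * wsum ?w m ?S"
      unfolding Suc using pos k Suc \<open>k = Suc m\<close>
      by (intro mult_left_mono wsum_degree_Suc_ge deg v) (auto simp: \<delta>_def)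
    finally show ?thesis
      using wsum_remove[OF fin i, of ?w l] unfolding Suc by (simp add: algebra_simps)
  qed
  \<comment> \<open>One more vertex multiplies the weight by at most \<open>n\<close>, which bounds
    the sum over lists of length \<open>m\<close> below in terms of \<open>surv\<close>.\<close>
  have "wsum ?w k ?S \<le> sum ?w ?S * wsum ?w m ?S"
    unfolding Suc by (intro wsum_Suc_le) auto
  also have "\<dots> \<le> real n * wsum ?w m ?S"
    unfolding sum_degree_remove[OF deg v] by (intro mult_right_mono wsum_nonneg) auto
  finally have wk: "wsum ?w k ?S / real n \<le> wsum ?w m ?S"
    using n by (simp add: field_simps)
  have "?A * (1 - \<delta>) * (wsum ?w k ?S / real n) \<le> ?A * (1 - \<delta>) * wsum ?w m ?S"
    using \<delta> wk by (intro mult_left_mono mult_nonneg_nonneg excess_nonneg)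
  also have "\<dots> = (\<Sum>i\<in>?S. (?w i - 1) * ?w i * ((1 - \<delta>) * wsum ?w m ?S))"
    unfolding excess_def sum_distrib_right[symmetric] by simp
  also have "\<dots> \<le> tail_weight n d v k"
    unfolding tail_weight_def Suc using rem
    by (intro sum_mono mult_left_mono pred_mult_nonneg) auto
  finally have 1: "?A * (1 - \<delta>) * (wsum ?w k ?S / real n) \<le> tail_weight n d v k" .
  have "?A / (real n)\<^sup>2 * (1 - \<delta>) * real k * surv n d v k
      = real k * (?A * (1 - \<delta>) * (wsum ?w k ?S / real n)) / (real n * falling n k)"
    by (simp add: surv_def power2_eq_square mult_ac)
  also have "\<dots> \<le> real k * tail_weight n d v k / (real n * falling n k)"
    using fpos 1 by (intro divide_right_mono mult_left_mono) auto
  also have "\<dots> \<le> real k * tail_weight n d v k / ((real n - real k) * falling n k)"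
    using npos n fpos tail_weight_nonneg
    by (intro divide_left_mono mult_right_mono mult_nonneg_nonneg mult_pos_pos) auto
  also have "\<dots> = coll_prob n d v k"
    by (simp add: coll_prob_def falling_Suc)
  finally show ?thesis unfolding \<delta>_def .
qed

text \<open>Multiply the bounds \<open>1 - x \<le> exp (- x)\<close>; the exponents
  \<open>k < K\<close> add up to \<open>K * (K - 1) / 2\<close>.\<close>

lemma prod_rec_le_exp:
  fixes p :: "nat \<Rightarrow> real"
  assumes "p 0 \<le> 1" "\<And>k. k < K \<Longrightarrow> p k \<ge> 0" "\<And>k. k < K \<Longrightarrow> p (Suc k) \<le> (1 - \<alpha> * real k) * p k"
  shows "p K \<le> exp (- \<alpha> * (real K * (real K - 1) / 2))"
proof -
  have "k \<le> K \<Longrightarrow> p k \<le> exp (- \<alpha> * (real k * (real k - 1) / 2))" for k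
  proof (induction k)
    case (Suc k)
    have "p (Suc k) \<le> (1 - \<alpha> * real k) * p k" using assms Suc by auto
    also have "\<dots> \<le> exp (- \<alpha> * real k) * p k"
      using assms(2) Suc exp_ge_add_one_self[of "- \<alpha> * real k"] by (intro mult_right_mono) auto
    also have "\<dots> \<le> exp (- \<alpha> * real k) * exp (- \<alpha> * (real k * (real k - 1) / 2))"
      using Suc by auto
    also have "\<dots> = exp (- \<alpha> * (real (Suc k) * (real (Suc k) - 1) / 2))"
      unfolding exp_add[symmetric] by (rule arg_cong[of _ _ exp]) (simp add: field_simps)
    finally show ?case .
  qed (use assms in auto)
  then show ?thesis by simp
qed

text \<open>Reverse estimate: for \<open>0 \<le> x \<le> \<theta> \<le> 1/2\<close>, the logarithm
  of \<open>1 - x\<close> is at least \<open>- (1 + 2 * \<theta>) * x\<close>. The linear hazard is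
  \<beta>; the constant \<gamma> is there for returns to the start.\<close>

lemma prod_rec_ge_exp:
  fixes p :: "nat \<Rightarrow> real"
  assumes p0: "p 0 \<ge> 1" and nonneg: "\<And>k. k < K \<Longrightarrow> p k \<ge> 0"
    and rec: "\<And>k. k < K \<Longrightarrow> p (Suc k) \<ge> (1 - (\<beta> * real k + \<gamma>)) * p k"
    and pos: "\<beta> \<ge> 0" "\<gamma> \<ge> 0" and \<theta>: "\<beta> * real K + \<gamma> \<le> \<theta>" "\<theta> \<le> 1/2"
  shows "p K \<ge> exp (- (1 + 2 * \<theta>) * (\<beta> * (real K)\<^sup>2 / 2 + \<gamma> * real K))"
proof -
  have \<theta>0: "\<theta> \<ge> 0" using \<theta> pos by (meson add_nonneg_nonneg mult_nonneg_nonneg of_nat_0_le_iff order_trans)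
  have *: "k \<le> K \<Longrightarrow> p k \<ge> exp (- (1 + 2 * \<theta>) * (\<beta> * (real k * (real k - 1)) / 2 + \<gamma> * real k))" for k
  proof (induction k)
    case (Suc k)
    let ?x = "\<beta> * real k + \<gamma>"
    have "\<beta> * real k \<le> \<beta> * real K" using Suc.prems pos by (intro mult_left_mono) auto
    then have x: "0 \<le> ?x" "?x \<le> \<theta>" using pos \<theta> by auto
    then have "- ?x - 2 * ?x\<^sup>2 \<le> ln (1 - ?x)"
      using \<theta> by (intro ln_one_minus_pos_lower_bound) auto
    moreover have "?x\<^sup>2 \<le> \<theta> * ?x" using x by (simp add: power2_eq_square mult_right_mono)
    ultimately have "- (1 + 2 * \<theta>) * ?x \<le> ln (1 - ?x)" by (simp add: algebra_simps)
    then have e: "exp (- (1 + 2 * \<theta>) * ?x) \<le> 1 - ?x"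
      using x \<theta> by (subst (asm) ln_ge_iff) auto
    have "exp (- (1 + 2 * \<theta>) * (\<beta> * (real (Suc k) * (real (Suc k) - 1)) / 2 + \<gamma> * real (Suc k)))
       = exp (- (1 + 2 * \<theta>) * ?x) * exp (- (1 + 2 * \<theta>) * (\<beta> * (real k * (real k - 1)) / 2 + \<gamma> * real k))"
      unfolding exp_add[symmetric] by (rule arg_cong[of _ _ exp]) (simp add: field_simps)
    also have "\<dots> \<le> (1 - ?x) * p k"
      using e Suc x \<theta> by (intro mult_mono) auto
    also have "\<dots> \<le> p (Suc k)" using rec Suc by auto
    finally show ?case .
  qed (use p0 in auto)
  \<comment> \<open>The induction needs the exact sum \<open>K * (K - 1) / 2\<close>; only the final
    bound is rounded to \<open>K\<close> squared.\<close>
  have "\<beta> * (real K * (real K - 1)) / 2 \<le> \<beta> * (real K)\<^sup>2 / 2"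
    using pos by (intro divide_right_mono mult_left_mono) (auto simp: power2_eq_square algebra_simps)
  then have "- (1 + 2 * \<theta>) * (\<beta> * (real K)\<^sup>2 / 2 + \<gamma> * real K)
      \<le> - (1 + 2 * \<theta>) * (\<beta> * (real K * (real K - 1)) / 2 + \<gamma> * real K)"
    using \<theta>0 by (intro mult_left_mono_neg) auto
  with *[of K] show ?thesis by (meson dual_order.trans exp_le_cancel_iff order_refl)
qed

text \<open>Returns to \<open>v\<close> only reduce survival, so an upper bound may drop
  them.\<close>

lemma surv_le_exp:
  assumes deg: "degree_seq n d" and v: "v \<in> {1..n}" and k: "K < n"
    and K: "2 * (real K * real (max_deg n d)) \<le> real n"
  shows "surv n d v K \<le> exp (- (excess n d v / (real n)\<^sup>2
        * (1 - real K * real (max_deg n d) / (real n - real K * real (max_deg n d))))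
        * (real K * (real K - 1) / 2))"
proof (rule prod_rec_le_exp)
  fix k assume kK: "k < K"
  show "surv n d v k \<ge> 0" using kK k by (intro surv_nonneg) auto
  then have "(1 - real (d v) / (real n - real k)) * surv n d v k \<le> 1 * surv n d v k"
    using kK k by (intro mult_right_mono) auto
  then show "surv n d v (Suc k) \<le> (1 - excess n d v / (real n)\<^sup>2
        * (1 - real K * real (max_deg n d) / (real n - real K * real (max_deg n d))) * real k) * surv n d v k"
    using surv_Suc[OF deg v, of k] coll_prob_ge[OF deg v _ k K, of k] kK k
    by (simp add: left_diff_distrib)
qed (simp add: surv_0)

text \<open>Both hazards enter a lower bound; the rate of returns to \<open>v\<close> is bounded by
  \<gamma> through the maximal degree.\<close>

lemma surv_ge_exp:
  fixes n d v K
  defines "D \<equiv> real (max_deg n d)"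
  defines "\<beta> \<equiv> excess n d v / ((real n - real K * D) * (real n - real K))"
  defines "\<gamma> \<equiv> D / (real n - real K)"
  assumes deg: "degree_seq n d" and v: "v \<in> {1..n}" and k: "K < n"
    and K: "real K * D < real n" and \<theta>: "\<beta> * real K + \<gamma> \<le> 1/2"
  shows "exp (- (1 + 2 * (\<beta> * real K + \<gamma>)) * (\<beta> * (real K)\<^sup>2 / 2 + \<gamma> * real K)) \<le> surv n d v K"
proof (rule prod_rec_ge_exp)
  fix k assume kK: "k < K"
  show nn: "surv n d v k \<ge> 0" using kK k by (intro surv_nonneg) auto
  have "real (d v) / (real n - real k) \<le> \<gamma>"
    unfolding \<gamma>_def D_def using le_max_deg[OF v, of d] kK k by (intro frac_le) auto
  then have "real (d v) / (real n - real k) * surv n d v k \<le> \<gamma> * surv n d v k"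
    using nn by (rule mult_right_mono)
  moreover have "coll_prob n d v k \<le> \<beta> * real k * surv n d v k"
    unfolding \<beta>_def D_def using kK K unfolding D_def by (intro coll_prob_le deg v k) auto
  ultimately show "surv n d v (Suc k) \<ge> (1 - (\<beta> * real k + \<gamma>)) * surv n d v k"
    using surv_Suc[OF deg v, of k] kK k by (simp add: algebra_simps)
next
  show "\<beta> \<ge> 0" unfolding \<beta>_def using excess_nonneg K k by simp
  show "\<gamma> \<ge> 0" unfolding \<gamma>_def D_def using k by simp
qed (use \<theta> in \<open>auto simp: surv_0\<close>)

subsection \<open>Local limit\<close>

text \<open>Isolates the four scaling facts that the limit rests on. Survival at time about
  \<open>c * x\<close> tends to \<open>exp (- x\<^sup>2 / 2)\<close> and the hazard there, times
  \<open>c\<close>, tends to \<open>x\<close>; the limit is their product.\<close>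

lemma coll_prob_local_limit:
  fixes d :: "nat \<Rightarrow> nat \<Rightarrow> nat" and v :: "nat \<Rightarrow> nat" and c :: "nat \<Rightarrow> real"
  assumes deg: "\<And>n. n \<ge> 1 \<Longrightarrow> degree_seq n (d n)" and vn: "\<And>n. n \<ge> 1 \<Longrightarrow> v n \<in> {1..n}"
    and c: "filterlim c at_top sequentially" and cn: "(\<lambda>n. c n / real n) \<longlonglongrightarrow> 0"
    and D: "(\<lambda>n. real (max_deg n (d n)) * c n / real n) \<longlonglongrightarrow> 0"
    and A: "(\<lambda>n. excess n (d n) (v n) * (c n)\<^sup>2 / (real n)\<^sup>2) \<longlonglongrightarrow> 1"
    and x: "x > 0"
  shows "(\<lambda>n. c n * coll_prob n (d n) (v n) (nat \<lfloor>c n * x\<rfloor>)) \<longlonglongrightarrow> x * exp (- x\<^sup>2 / 2)"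
proof -
  \<comment> \<open>Rescaled variables. Once \<open>c n > 0\<close>: \<open>u\<close> is
    \<open>K / c\<close>, \<open>r\<close> is \<open>K\<close> times the maximal degree over
    \<open>n\<close>, and \<open>s\<close> is \<open>K / n\<close>. The hazard coefficients of
    \<open>coll_prob_ge\<close> and \<open>coll_prob_le\<close>, multiplied by \<open>c\<close>
    squared, become \<open>a\<close> and \<open>b\<close>; \<theta> is the largest one-step hazard
    in \<open>surv_ge_exp\<close>.\<close>
  define K where "K n = nat \<lfloor>c n * x\<rfloor>" for n
  define M where "M n = real (max_deg n (d n))" for n
  define t where "t n = 1 / c n" for n
  define u where "u n = real (K n) * t n" for n
  define w where "w n = M n * c n / real n" for n
  define r where "r n = u n * w n" for n
  define s where "s n = u n * (c n / real n)" for n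
  define e where "e n = excess n (d n) (v n) * (c n)\<^sup>2 / (real n)\<^sup>2" for n
  define a where "a n = e n * (1 - r n / (1 - r n))" for n
  define b where "b n = e n / ((1 - r n) * (1 - s n))" for n
  define \<theta> where "\<theta> n = b n * u n * t n + w n * t n / (1 - s n)" for n
  define S where "S n = surv n (d n) (v n) (K n)" for n
  have cpos: "eventually (\<lambda>n. c n > 0) sequentially"
    using c by (simp add: filterlim_at_top_dense)
  have t: "t \<longlonglongrightarrow> 0"
    unfolding t_def by (intro tendsto_divide_0[OF tendsto_const] filterlim_at_top_imp_at_infinity c)
  have u: "u \<longlonglongrightarrow> x"
  proof (rule tendsto_sandwich[where f = "\<lambda>n. x - t n" and h = "\<lambda>_. x"])
    have K: "real (K n) \<le> c n * x" "c n * x - 1 \<le> real (K n)" if "c n > 0" for n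
    proof -
      have "\<lfloor>c n * x\<rfloor> \<ge> 0" using that x by simp
      then have "real (K n) = of_int \<lfloor>c n * x\<rfloor>" by (simp add: K_def)
      then show "real (K n) \<le> c n * x" "c n * x - 1 \<le> real (K n)" by linarith+
    qed
    show "\<forall>\<^sub>F n in sequentially. u n \<le> x"
      using cpos
    proof eventually_elim
      case (elim n)
      then show ?case using K(1)[OF elim] by (simp add: u_def t_def field_simps)
    qed
    show "\<forall>\<^sub>F n in sequentially. x - t n \<le> u n"
      using cpos
    proof eventually_elim
      case (elim n)
      then have "x - t n = (c n * x - 1) * t n" by (simp add: t_def field_simps)
      also have "\<dots> \<le> u n"
        unfolding u_def using K(2)[OF elim] elim by (intro mult_right_mono) (auto simp: t_def)
      finally show ?case .
    qed
    show "(\<lambda>n. x - t n) \<longlonglongrightarrow> x" using tendsto_diff[OF tendsto_const t, of x] by simp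
  qed simp
  have w: "w \<longlonglongrightarrow> 0" unfolding w_def M_def by (rule D)
  have r: "r \<longlonglongrightarrow> 0" unfolding r_def using tendsto_mult[OF u w] by simp
  have s: "s \<longlonglongrightarrow> 0" unfolding s_def using tendsto_mult[OF u cn] by simp
  have e: "e \<longlonglongrightarrow> 1" unfolding e_def by (rule A)
  have a: "a \<longlonglongrightarrow> 1" unfolding a_def by (rule tendsto_eq_intros e r | simp)+
  have b: "b \<longlonglongrightarrow> 1" unfolding b_def by (rule tendsto_eq_intros e r s | simp)+
  have \<theta>: "\<theta> \<longlonglongrightarrow> 0" unfolding \<theta>_def by (rule tendsto_eq_intros b u t w s | simp)+
  have lo: "(\<lambda>n. exp (- (1 + 2 * \<theta> n) * (b n * (u n)\<^sup>2 / 2 + w n * u n / (1 - s n)))) \<longlonglongrightarrow> exp (- x\<^sup>2 / 2)"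
  proof -
    have "(\<lambda>n. - (1 + 2 * \<theta> n) * (b n * (u n)\<^sup>2 / 2 + w n * u n / (1 - s n)))
        \<longlonglongrightarrow> - (1 + 2 * 0) * (1 * x\<^sup>2 / 2 + 0 * x / (1 - 0))"
      by (intro tendsto_intros \<theta> b u w s) simp_all
    from tendsto_exp[OF this] show ?thesis by simp
  qed
  have hi: "(\<lambda>n. exp (- a n * (u n * (u n - t n) / 2))) \<longlonglongrightarrow> exp (- x\<^sup>2 / 2)"
  proof -
    have "(\<lambda>n. - a n * (u n * (u n - t n) / 2)) \<longlonglongrightarrow> - 1 * (x * (x - 0) / 2)"
      by (intro tendsto_intros a u t) simp_all
    from tendsto_exp[OF this] show ?thesis by (simp add: power2_eq_square)
  qed
  \<comment> \<open>These inequalities imply the side conditions of the hazard and survival bounds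
    at \<open>K n\<close>.\<close>
  have ev: "eventually (\<lambda>n. c n > 0 \<and> n \<ge> 1 \<and> r n < 1/2 \<and> s n < 1/2 \<and> \<theta> n < 1/2) sequentially"
    using cpos eventually_ge_at_top[of 1] order_tendstoD(2)[OF r, of "1/2"]
      order_tendstoD(2)[OF s, of "1/2"] order_tendstoD(2)[OF \<theta>, of "1/2"]
    by (auto intro!: eventually_conj)
  have *: "exp (- (1 + 2 * \<theta> n) * (b n * (u n)\<^sup>2 / 2 + w n * u n / (1 - s n))) \<le> S n
      \<and> S n \<le> exp (- a n * (u n * (u n - t n) / 2))
      \<and> a n * u n * S n \<le> c n * coll_prob n (d n) (v n) (K n)
      \<and> c n * coll_prob n (d n) (v n) (K n) \<le> b n * u n * S n"
    if "c n > 0 \<and> n \<ge> 1 \<and> r n < 1/2 \<and> s n < 1/2 \<and> \<theta> n < 1/2" for n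
  proof -
    have cp: "c n > 0" and n: "real n > 0" and rs: "r n < 1/2" "s n < 1/2" and th: "\<theta> n < 1/2"
      using that by auto
    have dn: "degree_seq n (d n)" and v: "v n \<in> {1..n}" using that deg vn by auto
    have req: "r n = real (K n) * M n / real n" using cp by (simp add: r_def u_def w_def t_def)
    have seq: "s n = real (K n) / real n" using cp by (simp add: s_def u_def t_def)
    have K2: "2 * (real (K n) * M n) \<le> real n" using rs(1) n unfolding req by (simp add: field_simps)
    have K1: "real (K n) * M n < real n" using rs(1) n unfolding req by (simp add: field_simps)
    have Kn: "K n < n" using rs(2) n unfolding seq by (simp add: field_simps)
    have nK: "real n - real (K n) * M n = real n * (1 - r n)" "real n - real (K n) = real n * (1 - s n)"
      unfolding req seq using n by (auto simp: field_simps)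
    have al: "excess n (d n) (v n) / (real n)\<^sup>2 * (1 - real (K n) * M n / (real n - real (K n) * M n))
        = a n * (t n)\<^sup>2"
      unfolding nK a_def e_def t_def using cp n rs by (simp add: req field_simps)
    have be: "excess n (d n) (v n) / ((real n - real (K n) * M n) * (real n - real (K n))) = b n * (t n)\<^sup>2"
      unfolding nK b_def e_def t_def using cp n by (simp add: power2_eq_square)
    have ga: "M n / (real n - real (K n)) = w n * t n / (1 - s n)"
      unfolding nK w_def t_def using cp n by simp
    have Kt: "real (K n) = u n * c n" "t n * c n = 1" using cp by (simp_all add: u_def t_def)
    have th': "b n * (t n)\<^sup>2 * real (K n) + w n * t n / (1 - s n) = \<theta> n"
      unfolding \<theta>_def Kt power2_eq_square using Kt(2) by (simp add: algebra_simps)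
    have "exp (- (1 + 2 * \<theta> n) * (b n * (t n)\<^sup>2 * (real (K n))\<^sup>2 / 2 + w n * t n / (1 - s n) * real (K n))) \<le> S n"
      using surv_ge_exp[OF dn v Kn K1[unfolded M_def]] th
      unfolding M_def[symmetric] be ga th' S_def by simp
    moreover have "b n * (t n)\<^sup>2 * (real (K n))\<^sup>2 / 2 + w n * t n / (1 - s n) * real (K n)
        = b n * (u n)\<^sup>2 / 2 + w n * u n / (1 - s n)"
      by (simp add: u_def power_mult_distrib mult_ac)
    ultimately have 1: "exp (- (1 + 2 * \<theta> n) * (b n * (u n)\<^sup>2 / 2 + w n * u n / (1 - s n))) \<le> S n"
      by simp
    have "S n \<le> exp (- (a n * (t n)\<^sup>2) * (real (K n) * (real (K n) - 1) / 2))"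
      using surv_le_exp[OF dn v Kn K2[unfolded M_def]] unfolding M_def[symmetric] al S_def .
    moreover have "- (a n * (t n)\<^sup>2) * (real (K n) * (real (K n) - 1) / 2) = - a n * (u n * (u n - t n) / 2)"
      by (simp add: u_def power2_eq_square algebra_simps)
    ultimately have 2: "S n \<le> exp (- a n * (u n * (u n - t n) / 2))" by (simp only:)
    have "a n * (t n)\<^sup>2 * real (K n) * S n \<le> coll_prob n (d n) (v n) (K n)"
      using coll_prob_ge[OF dn v order_refl Kn K2[unfolded M_def]] unfolding M_def[symmetric] al S_def .
    then have "c n * (a n * (t n)\<^sup>2 * real (K n) * S n) \<le> c n * coll_prob n (d n) (v n) (K n)"
      using cp by simp
    moreover have "c n * (a n * (t n)\<^sup>2 * real (K n) * S n) = a n * u n * S n"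
      using cp by (simp add: u_def t_def power2_eq_square)
    ultimately have 3: "a n * u n * S n \<le> c n * coll_prob n (d n) (v n) (K n)" by simp
    have "coll_prob n (d n) (v n) (K n) \<le> b n * (t n)\<^sup>2 * real (K n) * S n"
      using coll_prob_le[OF dn v order_refl Kn K1[unfolded M_def]] unfolding M_def[symmetric] be S_def .
    then have "c n * coll_prob n (d n) (v n) (K n) \<le> c n * (b n * (t n)\<^sup>2 * real (K n) * S n)"
      using cp by simp
    moreover have "c n * (b n * (t n)\<^sup>2 * real (K n) * S n) = b n * u n * S n"
      using cp by (simp add: u_def t_def power2_eq_square)
    ultimately have 4: "c n * coll_prob n (d n) (v n) (K n) \<le> b n * u n * S n" by simp
    from 1 2 3 4 show ?thesis by blast
  qed
  \<comment> \<open>Both survival bounds have the same limit; inserting the limit of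
    \<open>S\<close> into the two hazard bounds squeezes the point mass.\<close>
  have S: "S \<longlonglongrightarrow> exp (- x\<^sup>2 / 2)"
    by (rule tendsto_sandwich[OF _ _ lo hi]) (use ev * in \<open>auto elim!: eventually_mono\<close>)
  have "(\<lambda>n. c n * coll_prob n (d n) (v n) (K n)) \<longlonglongrightarrow> x * exp (- x\<^sup>2 / 2)"
  proof (rule tendsto_sandwich)
    show "(\<lambda>n. a n * u n * S n) \<longlonglongrightarrow> x * exp (- x\<^sup>2 / 2)"
      using tendsto_mult[OF tendsto_mult[OF a u] S] by simp
    show "(\<lambda>n. b n * u n * S n) \<longlonglongrightarrow> x * exp (- x\<^sup>2 / 2)"
      using tendsto_mult[OF tendsto_mult[OF b u] S] by simp
  qed (use ev * in \<open>auto elim!: eventually_mono\<close>)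
  then show ?thesis unfolding K_def .
qed

section \<open>Scaling consequences of the degree hypotheses\<close>

lemma sigma2_nonneg:
  assumes "degree_seq n d" "n \<ge> 1"
  shows "sigma2 n d \<ge> 0"
proof -
  have "(\<Sum>j=1..n. d j) \<le> (\<Sum>j=1..n. d j ^ 2)"
    by (intro sum_mono) (simp add: power2_eq_square)
  then have "n \<le> moment 2 n d"
    using assms by (simp add: degree_seq_def moment_def)
  then have "real n \<le> real (moment 2 n d)" by simp
  then show ?thesis using assms(2) by (simp add: sigma2_def field_simps)
qed

context
  fixes d :: "nat \<Rightarrow> nat \<Rightarrow> nat" and v :: "nat \<Rightarrow> nat" and c :: "nat \<Rightarrow> real"
  defines "c \<equiv> \<lambda>n. sqrt (real n / sigma2 n (d n))"
  assumes deg: "\<And>n. n \<ge> 1 \<Longrightarrow> degree_seq n (d n)"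
    and vn: "\<And>n. n \<ge> 1 \<Longrightarrow> v n \<in> {1..n}"
    and h1: "(\<lambda>n. sigma2 n (d n)) \<in> o(\<lambda>n. real n / (ln (real n)) ^ 3)"
    and h2: "(\<lambda>n. 1 / real n) \<in> o(\<lambda>n. sigma2 n (d n))"
    and h3: "(\<lambda>n. real (max_deg n (d n)))
               \<in> o(\<lambda>n. sqrt (real n * sigma2 n (d n) / (ln (real n)) ^ 3))"
begin

text \<open>Smallness with constant 1 forces \<open>sigma2\<close> to be nonzero;
  \<open>n \<ge> 3\<close> makes the logarithm exceed 1.\<close>

lemma sigma2_pos_eventually: "eventually (\<lambda>n. n \<ge> 3 \<and> sigma2 n (d n) > 0) sequentially"
  using landau_o.smallD[OF h2 zero_less_one] eventually_ge_at_top[of 3]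
proof eventually_elim
  case (elim n)
  then have "sigma2 n (d n) \<noteq> 0" by auto
  then show ?case using elim sigma2_nonneg[OF deg[of n]] by auto
qed

lemma ln_cube_ge_1: "n \<ge> 3 \<Longrightarrow> ln (real n) ^ 3 \<ge> 1"
proof -
  assume "n \<ge> 3"
  then have "ln 3 \<le> ln (real n)" by simp
  with ln3_gt_1 show ?thesis by (intro one_le_power) linarith
qed

lemma scale_at_top: "filterlim c at_top sequentially"
proof -
  have "(\<lambda>n. sigma2 n (d n) / real n) \<longlonglongrightarrow> 0"
  proof (rule tendsto_sandwich[OF _ _ tendsto_const smalloD_tendsto[OF h1]])
    show "\<forall>\<^sub>F n in sequentially. 0 \<le> sigma2 n (d n) / real n"
      using sigma2_pos_eventually by eventually_elim simp
    show "\<forall>\<^sub>F n in sequentially. sigma2 n (d n) / real n \<le> sigma2 n (d n) / (real n / ln (real n) ^ 3)"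
      using sigma2_pos_eventually
    proof eventually_elim
      case (elim n)
      then show ?case using ln_cube_ge_1[of n] by (simp add: divide_right_mono)
    qed
  qed
  moreover have "\<forall>\<^sub>F n in sequentially. 0 < sigma2 n (d n) / real n"
    using sigma2_pos_eventually by eventually_elim simp
  ultimately have "filterlim (\<lambda>n. inverse (sigma2 n (d n) / real n)) at_top sequentially"
    by (rule filterlim_inverse_at_top)
  then show ?thesis
    unfolding c_def by (intro filterlim_compose[OF sqrt_at_top]) (simp add: inverse_eq_divide)
qed

text \<open>The quotient is the square root of \<open>1 / (n * sigma2)\<close>, which
  \<open>h2\<close> sends to 0.\<close>

lemma scale_over_n: "(\<lambda>n. c n / real n) \<longlonglongrightarrow> 0"
proof -
  have "(\<lambda>n. sqrt (1 / real n / sigma2 n (d n))) \<longlonglongrightarrow> 0"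
    using tendsto_real_sqrt[OF smalloD_tendsto[OF h2]] by simp
  moreover have "\<forall>\<^sub>F n in sequentially. sqrt (1 / real n / sigma2 n (d n)) = c n / real n"
    using sigma2_pos_eventually
  proof eventually_elim
    case (elim n)
    then have "c n / real n = sqrt (real n / sigma2 n (d n)) / sqrt ((real n)\<^sup>2)"
      by (simp add: c_def)
    also have "\<dots> = sqrt (1 / real n / sigma2 n (d n))"
      using elim unfolding real_sqrt_divide[symmetric] by (simp add: power2_eq_square)
    finally show ?case by simp
  qed
  ultimately show ?thesis by (rule Lim_transform_eventually)
qed

text \<open>Since \<open>c / n\<close> equals \<open>1 / sqrt (n * sigma2)\<close>, this is
  \<open>h3\<close> up to a power of the logarithm that is at least 1.\<close>

lemma max_deg_scale: "(\<lambda>n. real (max_deg n (d n)) * c n / real n) \<longlonglongrightarrow> 0"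
proof (rule tendsto_sandwich[OF _ _ tendsto_const smalloD_tendsto[OF h3]])
  show "\<forall>\<^sub>F n in sequentially. 0 \<le> real (max_deg n (d n)) * c n / real n"
    using sigma2_pos_eventually by eventually_elim (simp add: c_def)
  show "\<forall>\<^sub>F n in sequentially. real (max_deg n (d n)) * c n / real n
      \<le> real (max_deg n (d n)) / sqrt (real n * sigma2 n (d n) / ln (real n) ^ 3)"
    using sigma2_pos_eventually
  proof eventually_elim
    case (elim n)
    let ?s = "sigma2 n (d n)" and ?l = "ln (real n) ^ 3"
    have l: "?l \<ge> 1" using ln_cube_ge_1 elim by simp
    have pos: "real n > 0" "?s > 0" using elim by auto
    have "c n / real n = 1 / sqrt (real n * ?s)"
      using pos by (simp add: c_def real_sqrt_divide real_sqrt_mult field_simps)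
    also have "\<dots> \<le> 1 / sqrt (real n * ?s / ?l)"
      using pos l by (intro divide_left_mono real_sqrt_le_mono mult_pos_pos)
        (use elim in \<open>auto intro!: divide_pos_pos simp: divide_le_eq\<close>)
    finally have "real (max_deg n (d n)) * (c n / real n)
        \<le> real (max_deg n (d n)) * (1 / sqrt (real n * ?s / ?l))"
      by (intro mult_left_mono) auto
    then show ?case by simp
  qed
qed

text \<open>By \<open>excess_eq\<close> the expression is 1 minus the share of \<open>v\<close> in
  \<open>n * sigma2\<close>. That share is at most the square of the quantity in
  \<open>max_deg_scale\<close>.\<close>

lemma excess_scale: "(\<lambda>n. excess n (d n) (v n) * (c n)\<^sup>2 / (real n)\<^sup>2) \<longlonglongrightarrow> 1"
proof -
  let ?q = "\<lambda>n. (real (d n (v n)) - 1) * real (d n (v n)) / (real n * sigma2 n (d n))"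
  have "?q \<longlonglongrightarrow> 0"
  proof (rule tendsto_sandwich[OF _ _ tendsto_const])
    show "(\<lambda>n. (real (max_deg n (d n)) * c n / real n)\<^sup>2) \<longlonglongrightarrow> 0"
      using tendsto_power[OF max_deg_scale, of 2] by simp
    show "\<forall>\<^sub>F n in sequentially. 0 \<le> ?q n"
      using sigma2_pos_eventually by eventually_elim (simp add: pred_mult_nonneg)
    show "\<forall>\<^sub>F n in sequentially. ?q n \<le> (real (max_deg n (d n)) * c n / real n)\<^sup>2"
      using sigma2_pos_eventually
    proof eventually_elim
      case (elim n)
      have "real (d n (v n)) \<le> real (max_deg n (d n))" using le_max_deg[OF vn[of n]] elim by simp
      then have "(real (d n (v n)) - 1) * real (d n (v n)) \<le> (real (max_deg n (d n)))\<^sup>2"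
        unfolding power2_eq_square by (intro mult_mono) auto
      then have "?q n \<le> (real (max_deg n (d n)))\<^sup>2 / (real n * sigma2 n (d n))"
        using elim by (intro divide_right_mono) auto
      also have "\<dots> = (real (max_deg n (d n)) * c n / real n)\<^sup>2"
        using elim by (simp add: c_def power_mult_distrib power_divide) (simp add: power2_eq_square)
      finally show ?case .
    qed
  qed
  then have "(\<lambda>n. 1 - ?q n) \<longlonglongrightarrow> 1" using tendsto_diff[OF tendsto_const] by fastforce
  moreover have "\<forall>\<^sub>F n in sequentially. 1 - ?q n = excess n (d n) (v n) * (c n)\<^sup>2 / (real n)\<^sup>2"
    using sigma2_pos_eventually
  proof eventually_elim
    case (elim n)
    then have "(c n)\<^sup>2 = real n / sigma2 n (d n)" by (simp add: c_def)
    then have "(c n)\<^sup>2 / (real n)\<^sup>2 = 1 / (real n * sigma2 n (d n))"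
      using elim by (simp add: power2_eq_square)
    moreover have "1 - ?q n = excess n (d n) (v n) * (1 / (real n * sigma2 n (d n)))"
      using elim excess_eq[OF deg[of n] vn[of n]] by (simp add: diff_divide_distrib)
    ultimately show ?case by (metis times_divide_eq_right)
  qed
  ultimately show ?thesis by (rule Lim_transform_eventually)
qed

end

subsection \<open>From the local limit to weak convergence\<close>

lemma measurable_step:
  fixes h :: "nat \<Rightarrow> real"
  shows "(\<lambda>x::real. h (nat \<lfloor>c * x\<rfloor>)) \<in> borel_measurable borel"
proof -
  have "(\<lambda>x::real. nat \<lfloor>c * x\<rfloor>) \<in> measurable borel (count_space UNIV)" by measurable
  then show ?thesis by (rule measurable_compose) simp
qed

text \<open>A sequence read as a step function with cells of width \<open>1 / c\<close>. The
  indicator is essential: \<open>nat\<close> sends negative floors to 0, so \<open>h 0\<close> would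
  otherwise extend over the negative half-line.\<close>

lemma has_bochner_integral_step:
  fixes h :: "nat \<Rightarrow> real"
  assumes c: "c > 0" and h: "\<And>k. k \<ge> N \<Longrightarrow> h k = 0"
  shows "has_bochner_integral lborel (\<lambda>x. h (nat \<lfloor>c * x\<rfloor>) * indicator {0..} x) ((\<Sum>k<N. h k) / c)"
proof -
  have eq: "h (nat \<lfloor>c * x\<rfloor>) * indicator {0..} x
      = (\<Sum>k<N. h k * indicator {real k / c..<real (Suc k) / c} x)" for x
  proof (cases "x \<ge> 0")
    case False
    have "indicator {real k / c..<real (Suc k) / c} x = (0::real)" for k
    proof -
      have "real k / c \<ge> 0" using c by simp
      then show ?thesis using False by (simp add: indicator_def)
    qed
    then show ?thesis using False by simp
  next
    case True
    let ?m = "nat \<lfloor>c * x\<rfloor>"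
    have ind: "indicator {real k / c..<real (Suc k) / c} x = (if k = ?m then 1 else 0 :: real)" for k
    proof -
      have "x \<in> {real k / c..<real (Suc k) / c} \<longleftrightarrow> real k \<le> c * x \<and> c * x < real k + 1"
        using c by (auto simp: field_simps)
      also have "\<dots> \<longleftrightarrow> \<lfloor>c * x\<rfloor> = int k" by (simp add: floor_eq_iff)
      also have "\<dots> \<longleftrightarrow> k = ?m" using c True by auto
      finally show ?thesis by (simp add: indicator_def)
    qed
    have "(\<Sum>k<N. h k * indicator {real k / c..<real (Suc k) / c} x) = (if ?m < N then h ?m else 0)"
      unfolding ind by (simp add: if_distrib cong: if_cong)
    then show ?thesis using True h[of ?m] by auto
  qed
  have "has_bochner_integral lborel (\<lambda>x. \<Sum>k<N. h k * indicator {real k / c..<real (Suc k) / c} x)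
      (\<Sum>k<N. h k * (1 / c))"
  proof (intro has_bochner_integral_sum has_bochner_integral_mult_right)
    fix k
    have "real k / c \<le> real (Suc k) / c" using c by (simp add: divide_right_mono)
    moreover have "real (Suc k) / c - real k / c = 1 / c" by (simp flip: diff_divide_distrib)
    ultimately show "has_bochner_integral lborel (indicator {real k / c..<real (Suc k) / c}) (1 / c)"
      using has_bochner_integral_real_indicator[of "{real k / c..<real (Suc k) / c}" lborel]
      using c by (simp add: measure_def del: of_nat_Suc)
  qed
  then show ?thesis unfolding eq by (simp add: sum_divide_distrib)
qed

text \<open>Scheffe's lemma, with only an upper bound on the masses of \<open>a n\<close>, which
  suits subprobabilities. The absolute difference is \<open>a - f\<close> plus twice the positive
  part of \<open>f - a\<close>; the first has integral at most 0 and the second is dominated by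
  \<open>f\<close>.\<close>

lemma integral_abs_diff_tendsto_0:
  fixes f :: "'a \<Rightarrow> real" and a :: "nat \<Rightarrow> 'a \<Rightarrow> real"
  assumes f: "integrable M f" and f0: "\<And>x. f x \<ge> 0"
    and a: "\<And>n. a n \<in> borel_measurable M" "\<And>n x. a n x \<ge> 0"
    and ev: "eventually (\<lambda>n. integrable M (a n) \<and> integral\<^sup>L M (a n) \<le> integral\<^sup>L M f) sequentially"
    and lim: "AE x in M. (\<lambda>n. a n x) \<longlonglongrightarrow> f x"
  shows "(\<lambda>n. \<integral>x. \<bar>a n x - f x\<bar> \<partial>M) \<longlonglongrightarrow> 0"
proof -
  have [measurable]: "f \<in> borel_measurable M" "\<And>n. a n \<in> borel_measurable M" using f a by auto
  have lim0: "(\<lambda>n. \<integral>x. max 0 (f x - a n x) \<partial>M) \<longlonglongrightarrow> (\<integral>x. 0 \<partial>M)"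
  proof (rule integral_dominated_convergence[where w = f])
    show "AE x in M. (\<lambda>n. max 0 (f x - a n x)) \<longlonglongrightarrow> 0"
      using lim
    proof eventually_elim
      case (elim x)
      have "(\<lambda>n. max 0 (f x - a n x)) \<longlonglongrightarrow> max 0 (f x - f x)"
        by (intro tendsto_intros elim)
      then show ?case by simp
    qed
    show "AE x in M. norm (max 0 (f x - a n x)) \<le> f x" for n
      using f0 a(2) by (intro AE_I2) (auto simp: max_def)
  qed (use f in auto)
  have ub: "eventually (\<lambda>n. (\<integral>x. \<bar>a n x - f x\<bar> \<partial>M) \<le> 2 * (\<integral>x. max 0 (f x - a n x) \<partial>M)) sequentially"
    using ev
  proof eventually_elim
    case (elim n)
    have int: "integrable M (\<lambda>x. max 0 (f x - a n x))"
      by (rule Bochner_Integration.integrable_bound[OF f]) (use f0 a(2) in \<open>auto simp: max_def intro!: AE_I2\<close>)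
    have "\<bar>a n x - f x\<bar> = a n x - f x + 2 * max 0 (f x - a n x)" for x by (simp add: max_def abs_if)
    then have "(\<integral>x. \<bar>a n x - f x\<bar> \<partial>M) = integral\<^sup>L M (a n) - integral\<^sup>L M f + 2 * (\<integral>x. max 0 (f x - a n x) \<partial>M)"
      using elim f int by simp
    then show ?case using elim by simp
  qed
  have ub0: "(\<lambda>n. 2 * (\<integral>x. max 0 (f x - a n x) \<partial>M)) \<longlonglongrightarrow> 0"
    using tendsto_mult[OF tendsto_const lim0, of 2] by simp
  show ?thesis
    by (rule tendsto_sandwich[OF _ ub tendsto_const ub0]) simp
qed

section \<open>The Rayleigh and uniform limit law\<close>

definition rayleigh_density :: "real \<Rightarrow> real" where
  "rayleigh_density x = indicator {0<..} x * x * exp (- x\<^sup>2 / 2)"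

lemma rayleigh_density_nonneg: "rayleigh_density x \<ge> 0"
  by (simp add: rayleigh_density_def indicator_def)

lemma measurable_rayleigh_density [measurable]: "rayleigh_density \<in> borel_measurable borel"
  unfolding rayleigh_density_def by measurable

lemma has_bochner_integral_rayleigh_density: "has_bochner_integral lborel rayleigh_density 1"
proof (rule has_bochner_integral_nn_integral)
  have lim: "((\<lambda>x. - exp (- x\<^sup>2 / 2)) \<longlongrightarrow> 0) (at_top :: real filter)" by real_asymp
  have "(\<integral>\<^sup>+x. ennreal (rayleigh_density x) \<partial>lborel)
      = (\<integral>\<^sup>+x. ennreal (x * exp (- x\<^sup>2 / 2)) * indicator {0..} x \<partial>lborel)"
    by (intro nn_integral_cong) (auto simp: rayleigh_density_def indicator_def)
  also have "\<dots> = ennreal (0 - (- exp (- 0\<^sup>2 / 2)))"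
    by (rule nn_integral_FTC_atLeast[OF _ _ _ lim]) (auto intro!: derivative_eq_intros)
  finally show "(\<integral>\<^sup>+x. ennreal (rayleigh_density x) \<partial>lborel) = ennreal 1" by simp
qed (auto simp: rayleigh_density_nonneg)

lemma rayleigh_eq: "rayleigh = density lborel (\<lambda>x. ennreal (rayleigh_density x))"
  by (simp add: rayleigh_def rayleigh_density_def)

lemma prob_space_rayleigh: "prob_space rayleigh"
proof
  have "(\<integral>\<^sup>+x. ennreal (rayleigh_density x) \<partial>lborel) = ennreal 1"
    using has_bochner_integral_rayleigh_density
    by (subst nn_integral_eq_integral) (auto simp: rayleigh_density_nonneg has_bochner_integral_iff)
  then show "emeasure rayleigh (space rayleigh) = 1"
    by (simp add: rayleigh_eq emeasure_density)
qed

lemma unif01_eq: "unif01 = density lborel (\<lambda>x. ennreal (indicator {0..1} x))"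
  by (simp add: unif01_def uniform_measure_def ennreal_indicator divide_ennreal_def)

lemma prob_space_unif01: "prob_space unif01"
  unfolding unif01_def by (rule prob_space_uniform_measure) auto

text \<open>Fubini for the independent pair, after which both laws are replaced by their densities.
  Boundedness of \<open>g\<close> gives integrability.\<close>

lemma integral_limit_law:
  fixes g :: "real \<times> real \<Rightarrow> real"
  assumes g: "continuous_on UNIV g" and bd: "\<And>z. \<bar>g z\<bar> \<le> M"
  shows "integral\<^sup>L limit_law g
    = (\<integral>x. rayleigh_density x * (\<integral>u. indicator {0..1} u * g (x, u * x) \<partial>lborel) \<partial>lborel)"
proof -
  interpret R: prob_space rayleigh by (rule prob_space_rayleigh)
  interpret U: prob_space unif01 by (rule prob_space_unif01)
  interpret P: pair_prob_space rayleigh unif01 by unfold_locales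
  have [measurable]: "g \<in> borel_measurable borel" using g by (rule borel_measurable_continuous_onI)
  have [measurable_cong]: "sets rayleigh = sets borel" "sets unif01 = sets borel"
    by (simp_all add: rayleigh_eq unif01_eq)
  have "integral\<^sup>L limit_law g = (\<integral>z. g (fst z, snd z * fst z) \<partial>(rayleigh \<Otimes>\<^sub>M unif01))"
    unfolding limit_law_def by (subst integral_distr) (auto simp: split_def)
  also have "\<dots> = (\<integral>x. (\<integral>u. g (x, u * x) \<partial>unif01) \<partial>rayleigh)"
  proof (subst P.integral_fst'[symmetric])
    show "integrable (rayleigh \<Otimes>\<^sub>M unif01) (\<lambda>z. g (fst z, snd z * fst z))"
      by (rule P.integrable_const_bound[where B = M]) (auto simp: bd)
  qed simp
  also have "\<dots> = (\<integral>x. rayleigh_density x * (\<integral>u. g (x, u * x) \<partial>unif01) \<partial>lborel)"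
    unfolding rayleigh_eq by (subst integral_density) (auto simp: rayleigh_density_nonneg)
  also have "(\<lambda>x. \<integral>u. g (x, u * x) \<partial>unif01) = (\<lambda>x. \<integral>u. indicator {0..1} u * g (x, u * x) \<partial>lborel)"
    unfolding unif01_eq by (intro ext, subst integral_density) auto
  finally show ?thesis .
qed

lemma abs_floor_error: "0 \<le> y \<Longrightarrow> \<bar>real (nat \<lfloor>y\<rfloor>) - y\<bar> \<le> 1"
proof -
  assume "0 \<le> y"
  then have "real (nat \<lfloor>y\<rfloor>) = of_int \<lfloor>y\<rfloor>" by simp
  then show ?thesis by linarith
qed

lemma floor_scale_tendsto:
  fixes c :: "nat \<Rightarrow> real"
  assumes c: "filterlim c at_top sequentially" and x: "x \<ge> 0"
  shows "(\<lambda>n. real (nat \<lfloor>c n * x\<rfloor>) / c n) \<longlonglongrightarrow> x"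
proof -
  have "(\<lambda>n. real (nat \<lfloor>c n * x\<rfloor>) / c n - x) \<longlonglongrightarrow> 0"
  proof (rule Lim_null_comparison)
    show "(\<lambda>n. 1 / c n) \<longlonglongrightarrow> 0"
      by (intro tendsto_divide_0[OF tendsto_const] filterlim_at_top_imp_at_infinity c)
    have "eventually (\<lambda>n. c n > 0) sequentially" using c by (simp add: filterlim_at_top_dense)
    then show "\<forall>\<^sub>F n in sequentially. norm (real (nat \<lfloor>c n * x\<rfloor>) / c n - x) \<le> 1 / c n"
    proof eventually_elim
      case (elim n)
      then have "real (nat \<lfloor>c n * x\<rfloor>) / c n - x = (real (nat \<lfloor>c n * x\<rfloor>) - c n * x) / c n"
        by (simp add: field_simps)
      then show ?case using elim x abs_floor_error[of "c n * x"] by (simp add: divide_right_mono)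
    qed
  qed
  then show ?thesis by (simp add: LIM_zero_iff)
qed

text \<open>The inner average is a Riemann sum for the mean of \<open>g (x, U x)\<close> with \<open>U\<close> uniform.\<close>

lemma tail_average_tendsto:
  fixes g :: "real \<times> real \<Rightarrow> real" and c :: "nat \<Rightarrow> real"
  assumes g: "continuous_on UNIV g" and bd: "\<And>z. \<bar>g z\<bar> \<le> M"
    and c: "filterlim c at_top sequentially" and x: "x > 0"
  defines "K \<equiv> \<lambda>n. nat \<lfloor>c n * x\<rfloor>"
  shows "(\<lambda>n. (\<Sum>j<K n. g (real (Suc (K n)) / c n, real (Suc j) / c n)) / real (K n))
    \<longlonglongrightarrow> (\<integral>u. indicator {0..1} u * g (x, u * x) \<partial>lborel)"
proof -
  let ?J = "\<lambda>n u. nat \<lfloor>real (K n) * u\<rfloor>"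
  \<comment> \<open>Extended by 0 beyond \<open>K n\<close>, so that
    \<open>has_bochner_integral_step\<close> with cells of width \<open>1 / K n\<close> turns the
    average into an integral over \<open>u\<close>.\<close>
  define h where "h n j = (if j < K n then g (real (Suc (K n)) / c n, real (Suc j) / c n) else 0)" for n j
  have [measurable]: "g \<in> borel_measurable borel" using g by (rule borel_measurable_continuous_onI)
  have Kc: "(\<lambda>n. real (K n) / c n) \<longlonglongrightarrow> x" unfolding K_def by (rule floor_scale_tendsto) (use c x in auto)
  have inv: "(\<lambda>n. 1 / c n) \<longlonglongrightarrow> 0"
    by (intro tendsto_divide_0[OF tendsto_const] filterlim_at_top_imp_at_infinity c)
  have Kr: "filterlim (\<lambda>n. real (K n)) at_top sequentially"
  proof (rule filterlim_at_top_mono)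
    show "filterlim (\<lambda>n. - 1 + c n * x) at_top sequentially"
      by (intro filterlim_tendsto_add_at_top[OF tendsto_const]
          filterlim_at_top_mult_tendsto_pos[OF tendsto_const x c])
    show "\<forall>\<^sub>F n in sequentially. - 1 + c n * x \<le> real (K n)"
      unfolding K_def by (intro always_eventually allI) linarith
  qed
  have Kpos: "eventually (\<lambda>n. K n > 0) sequentially"
    using filterlim_at_top_dense[THEN iffD1, OF Kr, rule_format, of 0] by simp
  have "(\<lambda>n. \<integral>u. h n (?J n u) * indicator {0..} u \<partial>lborel)
      \<longlonglongrightarrow> (\<integral>u. indicator {0..1} u * g (x, u * x) \<partial>lborel)"
  proof (rule integral_dominated_convergence[where w = "\<lambda>u. M * indicator {0..1} u"])
    show "(\<lambda>u. indicator {0..1} u * g (x, u * x)) \<in> borel_measurable lborel" by measurable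
    show "(\<lambda>u. h n (?J n u) * indicator {0..} u) \<in> borel_measurable lborel" for n
      using measurable_step[of "h n" "real (K n)"] by measurable
    show "integrable lborel (\<lambda>u. M * indicator {0..1} (u::real))"
      by (intro integrable_mult_right integrable_real_indicator) auto
    have M: "M \<ge> 0" using bd[of "(0, 0)"] by linarith
    \<comment> \<open>The integrand vanishes from 1 on, so \<open>M\<close> times the indicator of
      the unit interval dominates it.\<close>
    have big: "h n (?J n u) = 0" if "u \<ge> 1" for n u
    proof -
      have "real (K n) * 1 \<le> real (K n) * u" using that by (intro mult_left_mono) auto
      then have "K n \<le> ?J n u" by (simp add: le_nat_floor)
      then show ?thesis by (simp add: h_def)
    qed
    show "AE u in lborel. norm (h n (?J n u) * indicator {0..} u) \<le> M * indicator {0..1} u" for n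
    proof (intro AE_I2)
      fix u :: real
      have "\<bar>h n (?J n u)\<bar> \<le> M" using bd M by (simp add: h_def)
      then show "norm (h n (?J n u) * indicator {0..} u) \<le> M * indicator {0..1} u"
        using big[of u n] M by (cases "u \<ge> 1") (auto simp: indicator_def)
    qed
    show "AE u in lborel. (\<lambda>n. h n (?J n u) * indicator {0..} u) \<longlonglongrightarrow> indicator {0..1} u * g (x, u * x)"
      \<comment> \<open>At \<open>u = 1\<close> the step functions are eventually 0 while the
        claimed limit is \<open>g (x, x)\<close>, so this point is left out.\<close>
      using AE_lborel_singleton[of 1]
    proof eventually_elim
      case (elim u)
      consider "u < 0" | "u > 1" | "0 \<le> u" "u < 1" using elim by linarith
      then show ?case
      proof cases
        case 2
        then show ?thesis using big[of u] by simp
      next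
        case 3
        have J: "(\<lambda>n. real (?J n u) / c n) \<longlonglongrightarrow> u * x"
        proof -
          have "(\<lambda>n. real (?J n u) / real (K n) * (real (K n) / c n)) \<longlonglongrightarrow> u * x"
            by (intro tendsto_mult Kc floor_scale_tendsto Kr 3)
          then show ?thesis
            by (rule Lim_transform_eventually) (use Kpos in \<open>auto elim!: eventually_mono\<close>)
        qed
        have Suc_lim: "(\<lambda>n. real (Suc (q n)) / c n) \<longlonglongrightarrow> y" if "(\<lambda>n. real (q n) / c n) \<longlonglongrightarrow> y" for q y
          using tendsto_add[OF inv that] by (simp add: add_divide_distrib)
        have "isCont g (x, u * x)" using g by (simp add: continuous_on_eq_continuous_at)
        then have "(\<lambda>n. g (real (Suc (K n)) / c n, real (Suc (?J n u)) / c n)) \<longlonglongrightarrow> g (x, u * x)"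
          by (rule isCont_tendsto_compose) (intro tendsto_Pair Suc_lim Kc J)
        moreover have "eventually (\<lambda>n. g (real (Suc (K n)) / c n, real (Suc (?J n u)) / c n)
            = h n (?J n u) * indicator {0..} u) sequentially"
          using Kpos
        proof eventually_elim
          case (elim n)
          have "real (K n) * u < real (K n)" using elim 3 by simp
          then have "?J n u < K n" using 3 by (simp add: nat_less_iff floor_less_iff)
          then show ?case using 3 by (simp add: h_def)
        qed
        ultimately have "(\<lambda>n. h n (?J n u) * indicator {0..} u) \<longlonglongrightarrow> g (x, u * x)"
          by (rule Lim_transform_eventually)
        then show ?thesis using 3 by simp
      qed simp
    qed
  qed
  moreover have "eventually (\<lambda>n. (\<integral>u. h n (?J n u) * indicator {0..} u \<partial>lborel)
      = (\<Sum>j<K n. g (real (Suc (K n)) / c n, real (Suc j) / c n)) / real (K n)) sequentially"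
    using Kpos
  proof eventually_elim
    case (elim n)
    have "has_bochner_integral lborel (\<lambda>u. h n (?J n u) * indicator {0..} u) ((\<Sum>j<K n. h n j) / real (K n))"
      by (rule has_bochner_integral_step) (use elim in \<open>auto simp: h_def\<close>)
    then show ?case by (simp add: has_bochner_integral_iff h_def)
  qed
  ultimately show ?thesis by (rule Lim_transform_eventually)
qed

text \<open>Rescale the masses to densities \<open>a n\<close>; the local limit makes them converge
  almost everywhere and Scheffe's lemma in mean. Mean convergence shows that no mass is lost and
  allows the bounded averages \<open>A\<close> to be integrated against the limit density
  instead.\<close>

lemma mixture_limit:
  fixes g :: "real \<times> real \<Rightarrow> real" and c :: "nat \<Rightarrow> real" and p :: "nat \<Rightarrow> nat \<Rightarrow> real"
  assumes g: "continuous_on UNIV g" and bd: "\<And>z. \<bar>g z\<bar> \<le> M"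
    and c: "filterlim c at_top sequentially" and c0: "\<And>n. c n \<ge> 0"
    and p0: "\<And>n k. p n k \<ge> 0" and pn: "\<And>n k. k \<ge> n \<Longrightarrow> p n k = 0"
    and p1: "\<And>n. n \<ge> 1 \<Longrightarrow> (\<Sum>k<n. p n k) \<le> 1"
    and lim: "\<And>x. x > 0 \<Longrightarrow> (\<lambda>n. c n * p n (nat \<lfloor>c n * x\<rfloor>)) \<longlonglongrightarrow> x * exp (- x\<^sup>2 / 2)"
  shows "(\<lambda>n. \<Sum>k<n. p n k) \<longlonglongrightarrow> 1"
    and "(\<lambda>n. \<Sum>k<n. p n k * ((\<Sum>j<k. g (real (Suc k) / c n, real (Suc j) / c n)) / real k))
      \<longlonglongrightarrow> integral\<^sup>L limit_law g"
proof -
  let ?f = rayleigh_density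
  define a where "a n x = c n * p n (nat \<lfloor>c n * x\<rfloor>) * indicator {0..} x" for n x
  define A where "A n k = (\<Sum>j<k. g (real (Suc k) / c n, real (Suc j) / c n)) / real k" for n k
  define G where "G x = (\<integral>u. indicator {0..1} u * g (x, u * x) \<partial>lborel)" for x
  have [measurable]: "g \<in> borel_measurable borel" using g by (rule borel_measurable_continuous_onI)
  have f: "integrable lborel ?f" "integral\<^sup>L lborel ?f = 1"
    using has_bochner_integral_rayleigh_density by (auto simp: has_bochner_integral_iff)
  have cpos: "eventually (\<lambda>n. c n > 0 \<and> n \<ge> 1) sequentially"
    using c eventually_ge_at_top[of 1] by (auto simp: filterlim_at_top_dense intro: eventually_conj)
  have a_meas [measurable]: "a n \<in> borel_measurable borel" for n
    unfolding a_def using measurable_step[of "\<lambda>k. c n * p n k" "c n"] by measurable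
  have A_meas [measurable]: "(\<lambda>x. A n (nat \<lfloor>c n * x\<rfloor>)) \<in> borel_measurable borel" for n
    by (rule measurable_step)
  have G_meas [measurable]: "G \<in> borel_measurable borel"
    unfolding G_def by measurable
  have a_int: "has_bochner_integral lborel (a n) (\<Sum>k<n. p n k)" if "c n > 0" for n
    using has_bochner_integral_step[of "c n" n "\<lambda>k. c n * p n k"] that pn
    by (simp add: a_def[abs_def] flip: sum_distrib_left)
  have aA_int: "has_bochner_integral lborel (\<lambda>x. a n x * A n (nat \<lfloor>c n * x\<rfloor>)) (\<Sum>k<n. p n k * A n k)"
    if "c n > 0" for n
    using has_bochner_integral_step[of "c n" n "\<lambda>k. c n * (p n k * A n k)"] that pn
    by (simp add: a_def mult_ac flip: sum_distrib_left)
  have a_lim: "AE x in lborel. (\<lambda>n. a n x) \<longlonglongrightarrow> ?f x"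
    \<comment> \<open>The assumption \<open>lim\<close> covers positive \<open>x\<close> only;
      negative \<open>x\<close> is trivial and 0 is a null set.\<close>
    using AE_lborel_singleton[of 0]
  proof eventually_elim
    case (elim x)
    then consider "x < 0" | "x > 0" by linarith
    then show ?case
      by cases (use lim[of x] in \<open>auto simp: a_def rayleigh_density_def\<close>)
  qed
  have diff: "(\<lambda>n. \<integral>x. \<bar>a n x - ?f x\<bar> \<partial>lborel) \<longlonglongrightarrow> 0"
  proof (rule integral_abs_diff_tendsto_0[OF f(1) rayleigh_density_nonneg _ _ _ a_lim])
    show "\<forall>\<^sub>F n in sequentially. integrable lborel (a n) \<and> integral\<^sup>L lborel (a n) \<le> integral\<^sup>L lborel ?f"
      using cpos by eventually_elim (use a_int p1 f(2) in \<open>auto simp: has_bochner_integral_iff\<close>)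
  qed (use c0 p0 in \<open>auto simp: a_def\<close>)
  show "(\<lambda>n. \<Sum>k<n. p n k) \<longlonglongrightarrow> 1"
  proof -
    have "(\<lambda>n. (\<Sum>k<n. p n k) - 1) \<longlonglongrightarrow> 0"
    proof (rule Lim_null_comparison[OF _ diff])
      show "\<forall>\<^sub>F n in sequentially. norm ((\<Sum>k<n. p n k) - 1) \<le> (\<integral>x. \<bar>a n x - ?f x\<bar> \<partial>lborel)"
        using cpos
      proof eventually_elim
        case (elim n)
        then have "(\<Sum>k<n. p n k) - 1 = (\<integral>x. a n x - ?f x \<partial>lborel)"
          using a_int[of n] f by (simp add: has_bochner_integral_iff)
        then show ?case using integral_abs_bound[of lborel "\<lambda>x. a n x - ?f x"] by simp
      qed
    qed
    then show ?thesis by (simp add: LIM_zero_iff)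
  qed
  have M: "M \<ge> 0" using bd[of "(0, 0)"] by linarith
  have A_bd: "\<bar>A n k\<bar> \<le> M" for n k
  proof -
    have "\<bar>\<Sum>j<k. g (real (Suc k) / c n, real (Suc j) / c n)\<bar> \<le> (\<Sum>j<k. M)"
      by (rule order_trans[OF sum_abs]) (intro sum_mono bd)
    then show ?thesis using M by (cases "k = 0") (auto simp: A_def field_simps)
  qed
  have A_lim: "(\<lambda>n. A n (nat \<lfloor>c n * x\<rfloor>)) \<longlonglongrightarrow> G x" if "x > 0" for x
    unfolding A_def G_def by (rule tail_average_tendsto[OF g bd c that])
  \<comment> \<open>First let the averages converge under the fixed Rayleigh density; exchanging
    \<open>a n\<close> for that density comes afterwards and costs at most \<open>M\<close> times
    the mean distance.\<close>
  have fA: "(\<lambda>n. \<integral>x. ?f x * A n (nat \<lfloor>c n * x\<rfloor>) \<partial>lborel) \<longlonglongrightarrow> (\<integral>x. ?f x * G x \<partial>lborel)"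
  proof (rule integral_dominated_convergence[where w = "\<lambda>x. M * ?f x"])
    show "AE x in lborel. norm (?f x * A n (nat \<lfloor>c n * x\<rfloor>)) \<le> M * ?f x" for n
      using mult_right_mono[OF A_bd rayleigh_density_nonneg]
      by (intro AE_I2) (simp add: abs_mult rayleigh_density_nonneg mult.commute)
    show "AE x in lborel. (\<lambda>n. ?f x * A n (nat \<lfloor>c n * x\<rfloor>)) \<longlonglongrightarrow> ?f x * G x"
    proof (intro AE_I2)
      fix x show "(\<lambda>n. ?f x * A n (nat \<lfloor>c n * x\<rfloor>)) \<longlonglongrightarrow> ?f x * G x"
        by (cases "x > 0") (auto intro!: tendsto_mult A_lim simp: rayleigh_density_def)
    qed
  qed (use f in auto)
  have "(\<lambda>n. (\<Sum>k<n. p n k * A n k) - (\<integral>x. ?f x * A n (nat \<lfloor>c n * x\<rfloor>) \<partial>lborel)) \<longlonglongrightarrow> 0"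
  proof (rule Lim_null_comparison)
    show "(\<lambda>n. M * (\<integral>x. \<bar>a n x - ?f x\<bar> \<partial>lborel)) \<longlonglongrightarrow> 0"
      using tendsto_mult[OF tendsto_const diff, of M] by simp
    show "\<forall>\<^sub>F n in sequentially. norm ((\<Sum>k<n. p n k * A n k) - (\<integral>x. ?f x * A n (nat \<lfloor>c n * x\<rfloor>) \<partial>lborel))
        \<le> M * (\<integral>x. \<bar>a n x - ?f x\<bar> \<partial>lborel)"
      using cpos
    proof eventually_elim
      case (elim n)
      let ?A = "\<lambda>x. A n (nat \<lfloor>c n * x\<rfloor>)"
      have i1: "integrable lborel (a n)" using a_int elim by (auto simp: has_bochner_integral_iff)
      have i2: "integrable lborel (\<lambda>x. ?f x * ?A x)"
      proof (rule Bochner_Integration.integrable_bound)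
        show "integrable lborel (\<lambda>x. M * ?f x)" using f by auto
        show "AE x in lborel. norm (?f x * ?A x) \<le> norm (M * ?f x)"
          using mult_right_mono[OF A_bd rayleigh_density_nonneg] M
          by (intro AE_I2) (simp add: abs_mult rayleigh_density_nonneg mult.commute)
      qed measurable
      have i3: "integrable lborel (\<lambda>x. a n x * ?A x)"
        "(\<Sum>k<n. p n k * A n k) = (\<integral>x. a n x * ?A x \<partial>lborel)"
        using aA_int elim by (auto simp: has_bochner_integral_iff)
      have i4: "integrable lborel (\<lambda>x. M * \<bar>a n x - ?f x\<bar>)" using i1 f by auto
      have "(\<Sum>k<n. p n k * A n k) - (\<integral>x. ?f x * ?A x \<partial>lborel) = (\<integral>x. a n x * ?A x - ?f x * ?A x \<partial>lborel)"
        using i2 i3 by simp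
      also have "norm \<dots> \<le> (\<integral>x. M * \<bar>a n x - ?f x\<bar> \<partial>lborel)"
      proof (rule order_trans[OF integral_norm_bound integral_mono])
        fix x
        show "norm (a n x * ?A x - ?f x * ?A x) \<le> M * \<bar>a n x - ?f x\<bar>"
          using mult_right_mono[OF A_bd abs_ge_zero]
          by (simp add: abs_mult mult.commute flip: left_diff_distrib)
      qed (use i2 i3 i4 in auto)
      finally show ?case by simp
    qed
  qed
  from tendsto_add[OF this fA]
  show "(\<lambda>n. \<Sum>k<n. p n k * ((\<Sum>j<k. g (real (Suc k) / c n, real (Suc j) / c n)) / real k))
      \<longlonglongrightarrow> integral\<^sup>L limit_law g"
    by (simp add: A_def G_def integral_limit_law[OF g bd])
qed

text \<open>For \<open>h = 0\<close> and \<open>M = 1\<close> the error bound in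
  \<open>expectation_rho_tail\<close> is itself the leftover mass, and it bounds an absolute
  value.\<close>

lemma sum_coll_prob_le_1:
  assumes "degree_seq n d" "v \<in> {1..n}"
  shows "(\<Sum>k<n. coll_prob n d v k) \<le> 1"
  using expectation_rho_tail[OF assms, of "\<lambda>_ _. 0" 1] by simp

theorem theorem2p3:
  fixes d :: "nat \<Rightarrow> nat \<Rightarrow> nat" and v :: "nat \<Rightarrow> nat"
  assumes deg: "\<And>n. n \<ge> 1 \<Longrightarrow> degree_seq n (d n)"
    and vn: "\<And>n. n \<ge> 1 \<Longrightarrow> v n \<in> {1..n}"
    and h1: "(\<lambda>n. sigma2 n (d n)) \<in> o(\<lambda>n. real n / (ln (real n)) ^ 3)"
    and h2: "(\<lambda>n. 1 / real n) \<in> o(\<lambda>n. sigma2 n (d n))"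
    and h3: "(\<lambda>n. real (max_deg n (d n)))
               \<in> o(\<lambda>n. sqrt (real n * sigma2 n (d n) / (ln (real n)) ^ 3))"
  shows "conv_distr2 (\<lambda>n. scaled_law n (d n) (v n)) limit_law"
proof -
  define c where "c n = sqrt (real n / sigma2 n (d n))" for n
  \<comment> \<open>Truncated at \<open>n\<close>, so that the sign and vanishing conditions of
    \<open>mixture_limit\<close> hold for every \<open>k\<close>.\<close>
  define p where "p n k = (if k < n then coll_prob n (d n) (v n) k else 0)" for n k
  note c_fold = c_def[abs_def, symmetric]
  have c_top: "filterlim c at_top sequentially"
    using scale_at_top[OF deg vn h1 h2 h3] unfolding c_fold .
  have c_n: "(\<lambda>n. c n / real n) \<longlonglongrightarrow> 0"
    using scale_over_n[OF deg vn h1 h2 h3] unfolding c_def .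
  have c0: "c n \<ge> 0" for n
    using sigma2_nonneg[OF deg[of n]] by (cases "n = 0") (auto simp: c_def)
  have p0: "p n k \<ge> 0" for n k
    by (simp add: p_def coll_prob_nonneg)
  have p_sum: "(\<Sum>k<n. p n k * w k) = (\<Sum>k<n. coll_prob n (d n) (v n) k * w k)" for n w
    by (simp add: p_def)
  have p1: "(\<Sum>k<n. p n k) \<le> 1" if "n \<ge> 1" for n
    using sum_coll_prob_le_1[OF deg vn] that by (simp add: p_def)
  have lim: "(\<lambda>n. c n * p n (nat \<lfloor>c n * x\<rfloor>)) \<longlonglongrightarrow> x * exp (- x\<^sup>2 / 2)" if x: "x > 0" for x
  proof (rule Lim_transform_eventually)
    show "(\<lambda>n. c n * coll_prob n (d n) (v n) (nat \<lfloor>c n * x\<rfloor>)) \<longlonglongrightarrow> x * exp (- x\<^sup>2 / 2)"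
      using max_deg_scale[OF deg vn h1 h2 h3] excess_scale[OF deg vn h1 h2 h3] x
      by (intro coll_prob_local_limit deg vn c_top c_n) (simp_all add: c_def)
    \<comment> \<open>Since \<open>c n * x\<close> is eventually below \<open>n\<close>, the
      truncation does not affect the local limit.\<close>
    have "(\<lambda>n. c n / real n * x) \<longlonglongrightarrow> 0" using tendsto_mult_right[OF c_n, of x] by simp
    then have "eventually (\<lambda>n. c n / real n * x < 1) sequentially" by (rule order_tendstoD) simp
    then show "\<forall>\<^sub>F n in sequentially.
        c n * coll_prob n (d n) (v n) (nat \<lfloor>c n * x\<rfloor>) = c n * p n (nat \<lfloor>c n * x\<rfloor>)"
      using eventually_ge_at_top[of 1]
    proof eventually_elim
      case (elim n)
      then have "c n * x < real n" by (simp add: field_simps)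
      moreover have "c n * x \<ge> 0" using c0 x by simp
      ultimately have "nat \<lfloor>c n * x\<rfloor> < n" by (simp add: nat_less_iff floor_less_iff)
      then show ?case by (simp add: p_def)
    qed
  qed
  show ?thesis
    unfolding conv_distr2_def
  proof (intro allI impI)
    fix g :: "real \<times> real \<Rightarrow> real"
    assume g: "continuous_on UNIV g" and "bounded (range g)"
    then obtain M where M: "\<bar>g z\<bar> \<le> M" for z by (auto simp: bounded_iff)
    have [measurable]: "g \<in> borel_measurable borel" using g by (rule borel_measurable_continuous_onI)
    \<comment> \<open>\<open>T\<close> is the contribution of positive tail-lengths; what remains is
      tail-length 0, whose mass tends to 0 by \<open>sum1\<close>.\<close>
    define T where "T n = (\<Sum>k<n. p n k * ((\<Sum>j<k. g (real (Suc k) / c n, real (Suc j) / c n)) / real k))" for n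
    have sum1: "(\<lambda>n. \<Sum>k<n. p n k) \<longlonglongrightarrow> 1" and T: "T \<longlonglongrightarrow> integral\<^sup>L limit_law g"
      unfolding T_def using mixture_limit[OF g M c_top c0 p0 _ p1 lim] by (simp_all add: p_def)
    have "(\<lambda>n. integral\<^sup>L (scaled_law n (d n) (v n)) g - T n) \<longlonglongrightarrow> 0"
    proof (rule Lim_null_comparison)
      show "(\<lambda>n. M * (1 - (\<Sum>k<n. p n k))) \<longlonglongrightarrow> 0"
        using tendsto_mult[OF tendsto_const tendsto_diff[OF tendsto_const sum1], of M 1] by simp
      show "\<forall>\<^sub>F n in sequentially. norm (integral\<^sup>L (scaled_law n (d n) (v n)) g - T n) \<le> M * (1 - (\<Sum>k<n. p n k))"
        using eventually_ge_at_top[of 1]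
      proof eventually_elim
        case (elim n)
        have "integral\<^sup>L (scaled_law n (d n) (v n)) g
            = measure_pmf.expectation (pmf_of_set (funs_deg n (d n)))
                (\<lambda>f. g (real (rho_len f (v n)) / c n, real (tail_len f (v n)) / c n))"
          unfolding scaled_law_def c_def by (subst integral_distr) auto
        then show ?case
          using expectation_rho_tail[OF deg[OF elim] vn[OF elim], of "\<lambda>a b. g (real a / c n, real b / c n)" M] M
          by (simp add: T_def p_def)
      qed
    qed
    from tendsto_add[OF this T]
    show "(\<lambda>n. integral\<^sup>L (scaled_law n (d n) (v n)) g) \<longlonglongrightarrow> integral\<^sup>L limit_law g" by simp
  qed
qed

end
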